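(* Let $R$ be a finite-dimensional regular quantum commutative algebra with regular quantum commutative decomposition $\mathscr{R}\colon R=R_1\oplus\cdots\oplus R_m$ of quantum length $m$ and decomposition matrix $M^R$. Suppose that $\operatorname{char}(K)\nmid m$. Then $\mathscr{R}$ is minimal if and only if $\det M^R\neq 0$. Moreover, in this case, $m=\dim C$ where $C$ is a simple subalgebra of $R$, and $\det M^R=\pm m^{m/2}$.
   Context: $K$ is an algebraically closed field of characteristic different from $2$; all algebras are unital associative $K$-algebras. A regular quantum commutative decomposition of an algebra $R$, of quantum length $m$, is a vector space decomposition $\mathscr{R}\colon R=R_1\oplus\cdots\oplus R_m$ such that, with $S=\{1,\dots,m\}$: (a) for every $n\in\mathbb{N}$ and every $n$-tuple $(i_1,\dots,i_n)\in S^n$ (repetitions allowed) there exist $a_j\in R_{i_j}$, $1\le j\le n$, with $a_1\cdots a_n\neq 0$; (b) there is a function $\theta\colon S\times S\to K^*$ (the regular quantum commutation function) such that $ab=\theta(i,j)ba$ for all $i,j\in S$, $a\in R_i$, $b\in R_j$. An algebra with a fixed such pair $(\mathscr{R},\theta)$ is called a regular quantum commutative algebra. Its decomposition matrix is $M^R=(\theta(i,j))_{1\le i,j\le m}$. The decomposition $\mathscr{R}$ is minimal if no two columns (equivalently, rows) of $M^R$ with different indices are equal. *)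

theory Defs
  imports "HOL-Library.FuncSet" "HOL-Computational_Algebra.Computational_Algebra"
    "Jordan_Normal_Form.Determinant"
begin

(* The class ring_1 excludes only the zero ring, which has no regular decomposition anyway. *)
locale unital_algebra = vector_space scale
  for scale :: "'k::field \<Rightarrow> 'a::ring_1 \<Rightarrow> 'a" (infixr \<open>*s\<close> 75) +
  assumes scale_mult_left: "(c *s x) * y = c *s (x * y)"
    and scale_mult_right: "x * (c *s y) = c *s (x * y)"
begin

definition finite_dimensional :: bool where
  "finite_dimensional \<longleftrightarrow> (\<exists>B. finite B \<and> span B = UNIV)"

definition direct_sum_decomposition :: "nat set \<Rightarrow> (nat \<Rightarrow> 'a set) \<Rightarrow> bool" where
  "direct_sum_decomposition S R \<longleftrightarrow>
     (\<forall>i\<in>S. subspace (R i)) \<and>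
     (\<forall>x. \<exists>!f. f \<in> (\<Pi>\<^sub>E i\<in>S. R i) \<and> (\<Sum>i\<in>S. f i) = x)"

(* R and \<theta> are relevant only on the index set {1..m}. *)
definition regular_qc_decomposition ::
    "nat \<Rightarrow> (nat \<Rightarrow> 'a set) \<Rightarrow> (nat \<Rightarrow> nat \<Rightarrow> 'k) \<Rightarrow> bool" where
  "regular_qc_decomposition m R \<theta> \<longleftrightarrow>
     direct_sum_decomposition {1..m} R \<and>
     (\<forall>is. set is \<subseteq> {1..m} \<longrightarrow>
        (\<exists>as. length as = length is \<and> (\<forall>j<length is. as ! j \<in> R (is ! j)) \<and>
              prod_list as \<noteq> 0)) \<and>
     (\<forall>i\<in>{1..m}. \<forall>j\<in>{1..m}. \<theta> i j \<noteq> 0 \<and>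
        (\<forall>a\<in>R i. \<forall>b\<in>R j. a * b = \<theta> i j *s (b * a)))"

(* A subalgebra is unital with respect to its own identity e, which may differ from that of
   the ambient algebra: M_2(K) x K has a regular decomposition of length 4, but its simple
   subalgebras of dimension 4 do not contain its identity. *)
definition subalgebra :: "'a set \<Rightarrow> bool" where
  "subalgebra C \<longleftrightarrow> subspace C \<and> (\<forall>x\<in>C. \<forall>y\<in>C. x * y \<in> C) \<and>
     (\<exists>e\<in>C. \<forall>x\<in>C. e * x = x \<and> x * e = x)"

definition two_sided_ideal_of :: "'a set \<Rightarrow> 'a set \<Rightarrow> bool" where
  "two_sided_ideal_of I C \<longleftrightarrow> subspace I \<and> I \<subseteq> C \<and>
     (\<forall>c\<in>C. \<forall>x\<in>I. c * x \<in> I \<and> x * c \<in> I)"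

definition simple_subalgebra :: "'a set \<Rightarrow> bool" where
  "simple_subalgebra C \<longleftrightarrow> subalgebra C \<and> C \<noteq> {0} \<and>
     (\<forall>I. two_sided_ideal_of I C \<longrightarrow> I = {0} \<or> I = C)"

end

(* Matrix positions are counted from 0, the components from 1. *)
definition decomposition_matrix :: "nat \<Rightarrow> (nat \<Rightarrow> nat \<Rightarrow> 'k) \<Rightarrow> 'k mat" where
  "decomposition_matrix m \<theta> = mat m m (\<lambda>(i, j). \<theta> (Suc i) (Suc j))"

definition minimal_decomposition :: "nat \<Rightarrow> (nat \<Rightarrow> nat \<Rightarrow> 'k) \<Rightarrow> bool" where
  "minimal_decomposition m \<theta> \<longleftrightarrow>
     (\<forall>i<m. \<forall>j<m. i \<noteq> j \<longrightarrow>
        col (decomposition_matrix m \<theta>) i \<noteq> col (decomposition_matrix m \<theta>) j)"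

end

theory Submission
  imports Defs
begin

text \<open>
  Write \<open>S = {1..m}\<close> for the index set and, for \<open>j \<in> S\<close>, let \<open>\<chi>\<^sub>j\<close> be the function
  \<open>k \<mapsto> \<theta> k j\<close>, that is, column \<open>j\<close> of the decomposition matrix \<open>M\<close>; minimality says that
  these columns are distinct. The idea is to cut \<open>R\<close> down by a central idempotent until every
  component contains an invertible element. After that, conjugation by these elements turns the
  decomposition into a grading by a finite group with a nondegenerate alternating bicharacter, and
  everything follows from the orthogonality of characters.

  \<^bold>\<open>Homogeneous units.\<close> Among the central idempotents \<open>e\<close> such that every word of components still
  has a nonzero product in \<open>e R\<close>, choose one with \<open>dim (e R)\<close> minimal. By the Fitting decomposition
  each homogeneous element splits \<open>e\<close> into two central idempotents, one on which it is nilpotent and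
  one on which it is invertible; one of the two still carries all words (concatenate a word that
  dies on one with a word that dies on the other). Hence, by minimality, each homogeneous element is
  nilpotent or invertible in \<open>e R\<close>. Long products of nilpotent elements of a single component
  vanish (\<open>prod_nilpotent_quasi_commuting\<close>), so each component provides a unit \<open>u\<^sub>i\<close> of \<open>e R\<close>
  (\<open>exists_homogeneous_units\<close>). The commutation rules of these units give \<open>\<theta> i i = 1\<close> and
  \<open>\<theta> i j * \<theta> j i = 1\<close>.

  \<^bold>\<open>The group.\<close> The elements of \<open>e R\<^sub>j\<close> are simultaneous eigenvectors of weight \<open>\<chi>\<^sub>j\<close> for the
  conjugations by the \<open>u\<^sub>k\<close>. When the columns are distinct, the \<open>e R\<^sub>j\<close> are the full eigenspaces, and no
  other weights occur (\<open>weight_occurs\<close>). Since products and inverses of units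
  have the product and inverse weights, the columns form a group under pointwise multiplication.
  Summing a nontrivial character over a group gives \<open>0\<close>, hence \<open>M * M = m \<cdot> 1\<close> (\<open>orthogonality\<close>), so \<open>det M ^ 2 = m ^ m\<close>. As \<open>m \<noteq> 0\<close>
  in \<open>K\<close>, \<open>det M\<close> is nonzero; conversely, a matrix with two equal columns has determinant \<open>0\<close>.

  \<^bold>\<open>The simple subalgebra.\<close> A maximal isotropic set \<open>H \<subseteq> S\<close> is its own orthogonal complement. With
  \<open>T\<close> a set of representatives of its cosets, orthogonality shows that the matrices \<open>(\<theta> t h)\<close> and
  \<open>(\<theta> h t)\<close>, \<open>t \<in> T\<close>, \<open>h \<in> H\<close>, are inverse to each other up to a scalar, in both orders, so
  \<open>card T = card H\<close> and \<open>m = card T ^ 2\<close> (\<open>card_representatives\<close>); thus \<open>m ^ (m/2)\<close> is a natural number.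
  The centralizer of the \<open>u\<^sub>h\<close>, \<open>h \<in> H\<close>,
  in \<open>e R\<close> is commutative. If \<open>f\<close> is a primitive idempotent of it, then each \<open>u\<^sub>h\<close> has a single nonzero
  eigenvalue on \<open>f R\<close>, and conjugation by \<open>u\<^sub>t\<close> multiplies this eigenvalue by a factor that differs from
  \<open>1\<close> for some \<open>h\<close> unless \<open>t\<close> lies in \<open>H\<close>. So the conjugates of \<open>f\<close> by \<open>u\<^sub>t\<close>, \<open>t \<in> T\<close>, are orthogonal, the
  elements \<open>u\<^sub>s * f * v\<^sub>t\<close> (with \<open>v\<^sub>t\<close> inverse to \<open>u\<^sub>t\<close>) are matrix units, and their span is a matrix
  algebra of dimension \<open>card T ^ 2 = m\<close>. It is a subalgebra with identity \<open>\<Sum>t\<in>T. u\<^sub>t * f * v\<^sub>t\<close>.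
\<close>

section \<open>Fitting idempotents in finite-dimensional algebras\<close>

context unital_algebra
begin

definition quasi_commute :: "'a \<Rightarrow> 'a \<Rightarrow> bool" where
  "quasi_commute a b \<longleftrightarrow> (\<exists>c. c \<noteq> 0 \<and> a * b = c *s (b * a))"

lemma quasi_commute_power:
  assumes "a * b = c *s (b * a)"
  shows "a ^ n * b = c ^ n *s (b * a ^ n)"
proof (induction n)
  case (Suc n)
  have "a ^ Suc n * b = a * (a ^ n * b)"
    by (simp add: mult.assoc)
  also have "\<dots> = c ^ n *s (a * b * a ^ n)"
    by (simp add: Suc.IH scale_mult_right mult.assoc)
  also have "\<dots> = c ^ Suc n *s (b * a ^ Suc n)"
    by (simp add: assms scale_mult_left mult.assoc mult.commute)
  finally show ?case .
qed simp

text \<open>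
  Evaluation of a polynomial at an element of the algebra, in Horner form; \<open>poly\<close> evaluates only
  at elements of the coefficient ring.
\<close>
definition peval :: "'a \<Rightarrow> 'k poly \<Rightarrow> 'a" where
  "peval x p = fold_coeffs (\<lambda>c y. c *s 1 + x * y) p 0"

lemma peval_0 [simp]: "peval x 0 = 0"
  by (simp add: peval_def)

lemma peval_pCons [simp]: "peval x (pCons c p) = c *s 1 + x * peval x p"
proof (cases "c = 0 \<and> p = 0")
  case False
  then show ?thesis
    by (auto simp: peval_def fold_coeffs_pCons_not_0_0_eq fold_coeffs_pCons_coeff_not_0_eq)
qed simp

lemma peval_1 [simp]: "peval x 1 = 1"
  by (simp add: one_pCons)

lemma peval_add: "peval x (p + q) = peval x p + peval x q"
  by (induction p q rule: poly_induct2) (simp_all add: algebra_simps scale_left_distrib)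

lemma peval_smult: "peval x (Polynomial.smult c p) = c *s peval x p"
  by (induction p) (simp_all add: scale_right_distrib scale_mult_right)

lemma peval_diff: "peval x (p - q) = peval x p - peval x q"
  using peval_add[of x "p - q" q] by simp

lemma peval_commute: "x * z = z * x \<Longrightarrow> peval x p * z = z * peval x p"
proof (induction p)
  case (pCons c p)
  have "x * peval x p * z = x * (z * peval x p)"
    using pCons by (simp add: mult.assoc)
  also have "\<dots> = z * (x * peval x p)"
    using pCons.prems by (simp add: mult.assoc[symmetric])
  finally show ?case
    by (simp add: distrib_left distrib_right scale_mult_left scale_mult_right)
qed simp

lemma peval_monom_mult: "peval x (monom 1 n * p) = x ^ n * peval x p"
  by (induction n) (simp_all add: monom_0 monom_Suc mult.assoc)

lemma subspace_range_mult: "subspace (range ((*) a))"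
  unfolding subspace_def
  by (auto intro: range_eqI[of _ _ 0] simp: scale_mult_right[symmetric] distrib_left[symmetric])

end

locale fin_dim_algebra = unital_algebra scale + finite_dimensional_vector_space scale Basis
  for scale :: "'k::field \<Rightarrow> 'a::ring_1 \<Rightarrow> 'a" (infixr \<open>*s\<close> 75) and Basis
begin

text \<open>
  The subspaces \<open>x ^ n * K[x]\<close> decrease with \<open>n\<close>, so one of minimal dimension equals its successor.
\<close>
lemma power_recurrence:
  fixes x :: 'a
  shows "\<exists>n q. x ^ n = x ^ Suc n * peval x q"
proof -
  define P where "P n = range (\<lambda>q. x ^ n * peval x q)" for n
  have sub: "subspace (P n)" for n
    unfolding subspace_def
  proof (intro conjI ballI allI)
    show "0 \<in> P n"
      unfolding P_def by (rule range_eqI[of _ _ 0]) simp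
    show "a + b \<in> P n" if "a \<in> P n" "b \<in> P n" for a b
      using that unfolding P_def
      by (auto simp: distrib_left[symmetric] peval_add[symmetric])
    show "c *s a \<in> P n" if "a \<in> P n" for c a
      using that unfolding P_def
      by (auto simp: scale_mult_right[symmetric] peval_smult[symmetric])
  qed
  obtain n where n: "\<And>k. dim (P n) \<le> dim (P k)"
    using ex_has_least_nat[of "\<lambda>_. True" 0 "\<lambda>n. dim (P n)"] by auto
  have "P (Suc n) \<subseteq> P n"
  proof
    fix z assume "z \<in> P (Suc n)"
    then obtain q where "z = x ^ Suc n * peval x q"
      by (auto simp: P_def)
    then have "z = x ^ n * peval x (pCons 0 q)"
      by (simp add: power_commutes mult.assoc[symmetric])
    then show "z \<in> P n"
      unfolding P_def by (rule range_eqI)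
  qed
  then have "P (Suc n) = P n"
    using subspace_dim_equal[OF sub sub] n by blast
  moreover have "x ^ n \<in> P n"
    unfolding P_def by (rule range_eqI[of _ _ 1]) simp
  ultimately have "x ^ n \<in> P (Suc n)" by simp
  then show ?thesis
    unfolding P_def by blast
qed

lemma annihilating_poly:
  fixes x :: 'a
  shows "\<exists>p. p \<noteq> 0 \<and> peval x p = 0"
proof -
  obtain n q where nq: "x ^ n = x ^ Suc n * peval x q"
    using power_recurrence by blast
  let ?p = "monom 1 n * (1 - pCons 0 q)"
  have "peval x ?p = x ^ n - x ^ n * (x * peval x q)"
    by (simp only: peval_monom_mult peval_diff peval_1 peval_pCons) (simp add: algebra_simps)
  also have "\<dots> = 0"
    using nq by (simp add: power_commutes mult.assoc[symmetric])
  finally have "peval x ?p = 0" .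
  moreover have "?p \<noteq> 0"
  proof -
    have "coeff (1 - pCons 0 q) 0 = 1" by simp
    then have "1 - pCons 0 q \<noteq> 0" by fastforce
    then show ?thesis by simp
  qed
  ultimately show ?thesis by blast
qed

text \<open>
  Iterating \<open>x ^ N = x ^ Suc N * Y\<close> gives \<open>x ^ n = x ^ (2 * n) * Y ^ n\<close>, so \<open>f = x ^ n * Y ^ n\<close> is the
  projection onto the Fitting component of \<open>x\<close>: \<open>x\<close> has inverse \<open>y\<close> on \<open>f\<close>, and \<open>x ^ n\<close> vanishes on
  \<open>1 - f\<close>. All these elements are polynomials in \<open>x\<close>, whence the commutation property.
\<close>
lemma fitting_idempotent:
  fixes x :: 'a
  obtains f g y n where "f * f = f" "f = x ^ n * g" "f = g * x ^ n" "x ^ n * f = x ^ n"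
    "f * x ^ n = x ^ n" "f = x * y" "\<And>z. x * z = z * x \<Longrightarrow> f * z = z * f \<and> y * z = z * y"
proof -
  obtain N q where Nq: "x ^ N = x ^ Suc N * peval x q"
    using power_recurrence by blast
  define Y where "Y = peval x q"
  have comm: "Y ^ k * z = z * Y ^ k" if "x * z = z * x" for z k
    using peval_commute[OF that] unfolding Y_def by (rule power_commuting_commutes)
  have xcomm: "x ^ k * z = z * x ^ k" if "x * z = z * x" for z k
    using that by (rule power_commuting_commutes)
  have xY: "x ^ j * Y ^ k = Y ^ k * x ^ j" for j k
    using comm[of "x ^ j" k] by (simp add: power_commutes)
  have step: "x ^ N = x ^ (N + k) * Y ^ k" for k
  proof (induction k)
    case (Suc k)
    have "x ^ N = x ^ (N + k) * Y ^ k" by (fact Suc)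
    also have "\<dots> = x ^ k * x ^ N * Y ^ k"
      by (simp add: power_add[symmetric] add.commute)
    also have "\<dots> = x ^ k * (x ^ Suc N * Y) * Y ^ k"
      using Nq unfolding Y_def by simp
    also have "\<dots> = x ^ (N + Suc k) * Y ^ Suc k"
      by (simp add: mult.assoc power_add power_commutes)
        (simp add: mult.assoc[symmetric] power_add[symmetric] power_Suc[symmetric] add.commute
          del: power_Suc)
    finally show ?case .
  qed simp
  define n where "n = Suc N"
  define f where "f = x ^ n * Y ^ n"
  have rec: "x ^ n = x ^ n * x ^ n * Y ^ n"
  proof -
    have "x ^ n = x * x ^ N" by (simp add: n_def)
    also have "\<dots> = x * (x ^ (N + n) * Y ^ n)" using step[of n] by simp
    also have "\<dots> = x ^ n * x ^ n * Y ^ n"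
      by (simp add: n_def power_add[symmetric] mult.assoc[symmetric] power_Suc[symmetric]
          del: power_Suc)
    finally show ?thesis .
  qed
  have xf: "x ^ n * f = x ^ n"
    using rec by (simp add: f_def mult.assoc)
  have fx: "f * x ^ n = x ^ n"
    using rec by (simp add: f_def mult.assoc xY[symmetric])
  show ?thesis
  proof (rule that[of f n "Y ^ n" "x ^ N * Y ^ n"])
    show "f * f = f"
      using fx by (simp add: f_def mult.assoc[symmetric])
    show "f = x ^ n * Y ^ n" by (fact f_def)
    show "f = Y ^ n * x ^ n" by (simp add: f_def xY)
    show "x ^ n * f = x ^ n" "f * x ^ n = x ^ n" by (fact xf fx)+
    show "f = x * (x ^ N * Y ^ n)"
      by (simp add: f_def n_def mult.assoc)
    show "f * z = z * f \<and> x ^ N * Y ^ n * z = z * (x ^ N * Y ^ n)" if "x * z = z * x" for z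
      unfolding f_def by (simp add: mult.assoc comm[OF that])
        (simp add: mult.assoc[symmetric] xcomm[OF that])
  qed
qed

text \<open>
  Moving \<open>x ^ n\<close> past \<open>r\<close> costs only a nonzero scalar, so the image and the kernel of \<open>x ^ n\<close> are
  both stable under \<open>r\<close>: \<open>f * r\<close> and \<open>r * f\<close> both equal \<open>f * r * f\<close>. Note that \<open>f\<close> and \<open>r\<close>
  commute exactly, although \<open>x\<close> and \<open>r\<close> commute only up to a scalar.
\<close>
lemma fitting_idempotent_central:
  assumes qc: "quasi_commute x r"
    and f: "f = x ^ n * g" "f = g * x ^ n" "x ^ n * f = x ^ n" "f * x ^ n = x ^ n"
  shows "f * r = r * f"
proof -
  obtain c where "c \<noteq> 0" and "x * r = c *s (r * x)"
    using qc unfolding quasi_commute_def by blast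
  then have xr: "x ^ n * r = c ^ n *s (r * x ^ n)" and "c ^ n \<noteq> 0"
    using quasi_commute_power by auto
  then have rx: "r * x ^ n = inverse (c ^ n) *s (x ^ n * r)"
    by simp
  have "f * r = g * (x ^ n * r)"
    using f(2) by (simp add: mult.assoc)
  also have "\<dots> = g * (x ^ n * r) * f"
    unfolding xr by (simp add: mult.assoc f(3) scale_mult_left scale_mult_right)
  also have "\<dots> = f * r * f"
    using f(2) by (simp add: mult.assoc)
  also have "\<dots> = f * (r * x ^ n) * g"
    by (subst (2) f(1)) (simp add: mult.assoc)
  also have "\<dots> = (r * x ^ n) * g"
    unfolding rx by (simp add: scale_mult_left scale_mult_right mult.assoc[symmetric] f(4))
  also have "\<dots> = r * f"
    by (simp add: mult.assoc f(1)[symmetric])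
  finally show ?thesis .
qed

section \<open>Products of quasi-commuting nilpotent elements\<close>

text \<open>
  Put \<open>p = prod_list xs\<close>. Since \<open>x * p\<close> is a multiple of \<open>p * x\<close>, left multiplication by \<open>x\<close>
  maps \<open>p R\<close> into itself, and as \<open>x\<close> is nilpotent the image is a proper subspace unless \<open>p = 0\<close>.
  So each further factor lowers the dimension of \<open>p R\<close>.
\<close>
lemma prod_nilpotent_quasi_commuting:
  assumes "\<And>x. x \<in> set xs \<Longrightarrow> \<exists>n. x ^ n = 0"
    and "\<And>x y. x \<in> set xs \<Longrightarrow> y \<in> set xs \<Longrightarrow> quasi_commute x y"
  shows "prod_list xs = 0 \<or> dim (range ((*) (prod_list xs))) + length xs \<le> dim UNIV"
  using assms
proof (induction xs)
  case Nil
  show ?case by (simp add: dim_subset)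
next
  case (Cons x xs)
  let ?p = "prod_list xs"
  have "\<exists>c. x * prod_list ys = c *s (prod_list ys * x)" if "set ys \<subseteq> set xs" for ys
    using that
  proof (induction ys)
    case Nil
    show ?case by (rule exI[of _ 1]) simp
  next
    case (Cons y ys)
    then obtain c where c: "x * prod_list ys = c *s (prod_list ys * x)" by auto
    obtain d where d: "x * y = d *s (y * x)"
      using Cons.prems \<open>\<And>a b. a \<in> set (x # xs) \<Longrightarrow> b \<in> set (x # xs) \<Longrightarrow> quasi_commute a b\<close>
      unfolding quasi_commute_def by (metis list.set_intros subset_code(1))
    have "x * (y * prod_list ys) = d *s (y * (x * prod_list ys))"
      by (metis d mult.assoc scale_mult_left)
    then show ?case
      by (auto simp: c scale_mult_right mult.assoc)
  qed
  then obtain c where c: "x * ?p = c *s (?p * x)" by blast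
  have sub: "range ((*) (x * ?p)) \<subseteq> range ((*) ?p)"
    by (auto simp: c scale_mult_left scale_mult_right[symmetric] mult.assoc)
  show ?case
  proof (cases "x * ?p = 0")
    case False
    then have p0: "?p \<noteq> 0" by auto
    have "range ((*) (x * ?p)) \<noteq> range ((*) ?p)"
    proof
      assume eq: "range ((*) (x * ?p)) = range ((*) ?p)"
      have "\<exists>r. ?p = x ^ k * (?p * r)" for k
      proof (induction k)
        case 0
        show ?case by (rule exI[of _ 1]) simp
      next
        case (Suc k)
        then obtain r where r: "?p = x ^ k * (?p * r)" by blast
        obtain s where s: "?p * r = x * ?p * s"
          using eq by blast
        have "?p = x ^ Suc k * (?p * s)"
          by (subst r, subst s) (simp add: power_commutes mult.assoc[symmetric])
        then show ?case by blast
      qed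
      moreover obtain k where "x ^ k = 0"
        using Cons.prems(1) by auto
      ultimately show False
        using p0 by (metis mult_zero_left)
    qed
    then have "dim (range ((*) (x * ?p))) < dim (range ((*) ?p))"
      using subspace_dim_equal[OF subspace_range_mult subspace_range_mult sub]
        dim_subset[OF sub] by linarith
    moreover have "dim (range ((*) ?p)) + length xs \<le> dim UNIV"
      using Cons p0 by auto
    ultimately show ?thesis by simp
  qed simp
qed

text \<open>
  This makes \<open>dim (e R)\<close> a termination measure for shrinking an idempotent \<open>e\<close>.
\<close>
lemma dim_corner_less:
  assumes "f \<noteq> g" "f * g = g" "g * f = g" "g * g = g"
  shows "dim (range ((*) g)) < dim (range ((*) f))"
proof -
  have sub: "range ((*) g) \<subseteq> range ((*) f)"
  proof
    fix z assume "z \<in> range ((*) g)"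
    then obtain r where "z = g * r" by blast
    then have "z = f * (g * r)"
      using assms(2) by (simp add: mult.assoc[symmetric])
    then show "z \<in> range ((*) f)" by blast
  qed
  have "range ((*) g) \<noteq> range ((*) f)"
  proof
    assume "range ((*) g) = range ((*) f)"
    then obtain r where "f * 1 = g * r" by blast
    then have fr: "f = g * r" by simp
    have "g * f = f"
      unfolding fr using assms(4) by (simp add: mult.assoc[symmetric])
    then show False using assms by simp
  qed
  then show ?thesis
    using subspace_dim_equal[OF subspace_range_mult subspace_range_mult sub]
      dim_subset[OF sub] by linarith
qed

end

section \<open>A central idempotent with invertible homogeneous elements\<close>

locale regular_qc_algebra = fin_dim_algebra scale Basis
  for scale :: "'k::field \<Rightarrow> 'a::ring_1 \<Rightarrow> 'a" (infixr \<open>*s\<close> 75) and Basis +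
  fixes m :: nat and R :: "nat \<Rightarrow> 'a set" and \<theta> :: "nat \<Rightarrow> nat \<Rightarrow> 'k"
  assumes regular: "regular_qc_decomposition m R \<theta>"
begin

lemma components: "\<exists>a. (\<forall>i\<in>{1..m}. a i \<in> R i) \<and> x = (\<Sum>i\<in>{1..m}. a i)"
proof -
  obtain a where "a \<in> (\<Pi>\<^sub>E i\<in>{1..m}. R i)" "(\<Sum>i\<in>{1..m}. a i) = x"
    using regular unfolding regular_qc_decomposition_def direct_sum_decomposition_def by blast
  then show ?thesis by auto
qed

lemma component_commute:
  "i \<in> {1..m} \<Longrightarrow> j \<in> {1..m} \<Longrightarrow> a \<in> R i \<Longrightarrow> b \<in> R j \<Longrightarrow> a * b = \<theta> i j *s (b * a)"
  using regular unfolding regular_qc_decomposition_def by blast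

lemma theta_nonzero: "i \<in> {1..m} \<Longrightarrow> j \<in> {1..m} \<Longrightarrow> \<theta> i j \<noteq> 0"
  using regular unfolding regular_qc_decomposition_def by blast

definition central :: "'a \<Rightarrow> bool" where
  "central z \<longleftrightarrow> (\<forall>r. z * r = r * z)"

lemma centralI:
  assumes "\<And>i r. i \<in> {1..m} \<Longrightarrow> r \<in> R i \<Longrightarrow> z * r = r * z"
  shows "central z"
  unfolding central_def
proof
  fix r
  obtain a where "\<forall>i\<in>{1..m}. a i \<in> R i" "r = (\<Sum>i\<in>{1..m}. a i)"
    using components by blast
  then show "z * r = r * z"
    using assms by (simp add: sum_distrib_left sum_distrib_right)
qed

text \<open>
  For a central idempotent \<open>e\<close>: the images of the components in \<open>e R\<close> inherit the nonvanishing
  condition of a regular decomposition.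
\<close>
definition full :: "'a \<Rightarrow> bool" where
  "full e \<longleftrightarrow> (\<forall>is. set is \<subseteq> {1..m} \<longrightarrow>
     (\<exists>as. list_all2 (\<lambda>a i. a \<in> R i) as is \<and> e * prod_list as \<noteq> 0))"

lemma full_1: "full 1"
  unfolding full_def
proof (intro allI impI)
  fix ks :: "nat list" assume "set ks \<subseteq> {1..m}"
  then obtain as where "length as = length ks" "\<forall>j<length ks. as ! j \<in> R (ks ! j)" "prod_list as \<noteq> 0"
    using regular unfolding regular_qc_decomposition_def by blast
  then have "list_all2 (\<lambda>a i. a \<in> R i) as ks \<and> 1 * prod_list as \<noteq> 0"
    by (simp add: list_all2_conv_all_nth)
  then show "\<exists>as. list_all2 (\<lambda>a i. a \<in> R i) as ks \<and> 1 * prod_list as \<noteq> 0"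
    by blast
qed

text \<open>
  If one word dies on \<open>f\<close> and another dies on \<open>g\<close>, their concatenation dies on \<open>f + g\<close>;
  as \<open>g\<close> is central, it can be moved to the second word.
\<close>
lemma full_split:
  assumes "full (f + g)" "central g"
  shows "full f \<or> full g"
proof (rule ccontr)
  assume "\<not> (full f \<or> full g)"
  then obtain ks js where i: "set ks \<subseteq> {1..m}" "set js \<subseteq> {1..m}"
    and f0: "\<And>as. list_all2 (\<lambda>a i. a \<in> R i) as ks \<Longrightarrow> f * prod_list as = 0"
    and g0: "\<And>as. list_all2 (\<lambda>a i. a \<in> R i) as js \<Longrightarrow> g * prod_list as = 0"
    unfolding full_def by blast
  then have "set (ks @ js) \<subseteq> {1..m}" by simp
  then obtain cs where cs: "list_all2 (\<lambda>a i. a \<in> R i) cs (ks @ js)" "(f + g) * prod_list cs \<noteq> 0"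
    using assms(1) unfolding full_def by blast
  then obtain as bs where ab: "cs = as @ bs" "list_all2 (\<lambda>a i. a \<in> R i) as ks"
      "list_all2 (\<lambda>a i. a \<in> R i) bs js"
    by (auto simp: list_all2_append2)
  have "(f + g) * prod_list cs = f * prod_list as * prod_list bs + prod_list as * (g * prod_list bs)"
  proof -
    have "g * prod_list as = prod_list as * g"
      using assms(2) by (simp add: central_def)
    then show ?thesis
      by (simp add: ab(1) distrib_right mult.assoc[symmetric])
  qed
  then show False
    using cs(2) f0[OF ab(2)] g0[OF ab(3)] by simp
qed

lemma exists_minimal_full_idempotent:
  obtains e where "e * e = e" "central e" "full e"
    "\<And>f. f * f = f \<Longrightarrow> central f \<Longrightarrow> full f \<Longrightarrow> f * e = f \<Longrightarrow> f = e"
proof -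
  define P where "P e \<longleftrightarrow> e * e = e \<and> central e \<and> full e" for e
  have "P 1"
    by (simp add: P_def full_1 central_def)
  then obtain e where e: "P e" and least: "\<And>f. P f \<Longrightarrow> dim (range ((*) e)) \<le> dim (range ((*) f))"
    using ex_has_least_nat[of P 1 "\<lambda>e. dim (range ((*) e))"] by blast
  show ?thesis
  proof (rule that[of e])
    show "f = e" if f: "f * f = f" "central f" "full f" "f * e = f" for f
    proof (rule ccontr)
      assume "f \<noteq> e"
      have "e * f = f"
        using f(2,4) by (simp add: central_def)
      then have "dim (range ((*) f)) < dim (range ((*) e))"
        using dim_corner_less[of e f] \<open>f \<noteq> e\<close> f(1,4) by auto
      moreover have "P f"
        using f by (simp add: P_def)
      ultimately show False
        using least[of f] by simp
    qed
  qed (use e in \<open>auto simp: P_def\<close>)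
qed

text \<open>
  The Fitting idempotent \<open>f\<close> of \<open>e * x\<close> is central because \<open>x\<close> is homogeneous. By \<open>full_split\<close> one
  of \<open>f\<close> and \<open>e - f\<close> is full, hence equal to \<open>e\<close> by minimality; \<open>e * x\<close> is a unit of \<open>e R\<close> in the
  first case and nilpotent in the second.
\<close>
lemma homogeneous_nilpotent_or_unit:
  assumes e: "e * e = e" "central e" "full e"
    and minimal: "\<And>f. f * f = f \<Longrightarrow> central f \<Longrightarrow> full f \<Longrightarrow> f * e = f \<Longrightarrow> f = e"
    and x: "i \<in> {1..m}" "x \<in> R i"
  shows "(\<exists>n. (e * x) ^ n = 0) \<or> (\<exists>y. e * x * y = e \<and> y * (e * x) = e \<and> e * y = y)"
proof -
  have ec: "e * r = r * e" for r
    using e(2) by (simp add: central_def)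
  obtain f g y n where fi: "f * f = f" "f = (e * x) ^ n * g" "f = g * (e * x) ^ n"
      "(e * x) ^ n * f = (e * x) ^ n" "f * (e * x) ^ n = (e * x) ^ n" "f = e * x * y"
      "\<And>z. e * x * z = z * (e * x) \<Longrightarrow> f * z = z * f \<and> y * z = z * y"
    using fitting_idempotent[of "e * x"] by metis
  have cf: "central f"
  proof (rule centralI)
    fix j r assume j: "j \<in> {1..m}" "r \<in> R j"
    have "e * x * r = \<theta> i j *s (e * r * x)"
      by (simp add: mult.assoc component_commute[OF x(1) j(1) x(2) j(2)] scale_mult_right)
    also have "e * r * x = r * (e * x)"
      unfolding ec[of r] by (simp add: mult.assoc)
    finally have "e * x * r = \<theta> i j *s (r * (e * x))" .
    then have "quasi_commute (e * x) r"
      unfolding quasi_commute_def using theta_nonzero[OF x(1) j(1)] by blast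
    then show "f * r = r * f"
      using fitting_idempotent_central fi(2-5) by blast
  qed
  have ef: "e * f = f"
    using e(1) by (simp add: fi(6) mult.assoc[symmetric])
  then have fe: "f * e = f" using ec[of f] by simp
  have "full f \<or> full (e - f)"
  proof (rule full_split)
    show "central (e - f)"
      using e(2) cf by (simp add: central_def algebra_simps)
  qed (simp add: e(3))
  then show ?thesis
  proof
    assume "full f"
    then have "f = e"
      using minimal fi(1) cf fe by blast
    then have exy: "e * x * y = e"
      using fi(6) by simp
    moreover have "y * (e * x) = e * x * y"
      using fi(7)[of "e * x"] by simp
    ultimately have "y * (e * x) = e" by simp
    have "e * x * (e * y) = e * x * (y * e)"
      unfolding ec[of y] ..
    also have "\<dots> = e * (e * x * y)"
      unfolding ec[of "e * x * y"] by (simp add: mult.assoc)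
    finally have "e * x * (e * y) = e * (e * x * y)" .
    then have "e * x * (e * y) = e"
      using exy e(1) by simp
    moreover have "e * y * (e * x) = e * (y * (e * x))"
      by (simp add: mult.assoc)
    then have "e * y * (e * x) = e"
      using \<open>y * (e * x) = e\<close> e(1) by simp
    moreover have "e * (e * y) = e * y"
      using e(1) by (simp add: mult.assoc[symmetric])
    ultimately have "e * x * (e * y) = e \<and> e * y * (e * x) = e \<and> e * (e * y) = e * y"
      by blast
    then show ?thesis by blast
  next
    assume "full (e - f)"
    moreover have "(e - f) * (e - f) = e - f" "(e - f) * e = e - f"
      using e(1) fi(1) ef fe by (simp_all add: algebra_simps)
    moreover have "central (e - f)"
      using e(2) cf by (simp add: central_def algebra_simps)
    ultimately have "e - f = e"
      using minimal by blast
    then have "f = 0" by simp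
    then have "(e * x) ^ n = 0"
      using fi(4) by simp
    then show ?thesis by blast
  qed
qed

text \<open>
  Otherwise all elements of \<open>e * R i\<close> are nilpotent, and the word \<open>i i \<dots> i\<close> of length
  \<open>dim R + 1\<close> has only zero products on \<open>e\<close>.
\<close>
lemma exists_homogeneous_unit:
  assumes e: "e * e = e" "central e" "full e"
    and minimal: "\<And>f. f * f = f \<Longrightarrow> central f \<Longrightarrow> full f \<Longrightarrow> f * e = f \<Longrightarrow> f = e"
    and i: "i \<in> {1..m}"
  shows "\<exists>x\<in>R i. \<exists>y. e * x * y = e \<and> y * (e * x) = e \<and> e * y = y"
proof (rule ccontr)
  assume "\<not> ?thesis"
  then have nil: "\<exists>n. (e * x) ^ n = 0" if "x \<in> R i" for x
    using homogeneous_nilpotent_or_unit[OF assms that] that by blast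
  have ec: "e * r = r * e" for r
    using e(2) by (simp add: central_def)
  have "set (replicate (Suc (dim UNIV)) i) \<subseteq> {1..m}"
    using i by (metis in_set_replicate subsetI)
  then obtain as where as: "list_all2 (\<lambda>a i. a \<in> R i) as (replicate (Suc (dim UNIV)) i)"
      "e * prod_list as \<noteq> 0"
    using e(3) unfolding full_def by blast
  have len: "length as = Suc (dim UNIV)"
    using list_all2_lengthD[OF as(1)] by simp
  have asR: "a \<in> R i" if "a \<in> set as" for a
    using as(1) that len unfolding list_all2_conv_all_nth
    by (metis in_set_conv_nth length_replicate nth_replicate)
  let ?ys = "map ((*) e) as"
  have "prod_list ?ys = 0"
  proof -
    have "quasi_commute x y" if xy: "x \<in> set ?ys" "y \<in> set ?ys" for x y
    proof -
      obtain a b where ab: "x = e * a" "y = e * b" "a \<in> R i" "b \<in> R i"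
        using xy asR by auto
      have "x * y = e * e * (a * b)"
        unfolding ab(1,2) by (metis ec mult.assoc)
      also have "\<dots> = \<theta> i i *s (e * e * (b * a))"
        by (simp add: component_commute[OF i i ab(3,4)] scale_mult_right)
      also have "e * e * (b * a) = y * x"
        unfolding ab(1,2) by (metis ec mult.assoc)
      finally show ?thesis
        unfolding quasi_commute_def using theta_nonzero[OF i i] by blast
    qed
    moreover have "\<exists>n. x ^ n = 0" if "x \<in> set ?ys" for x
      using that nil asR by auto
    ultimately show ?thesis
      using prod_nilpotent_quasi_commuting[of ?ys] len by auto
  qed
  moreover have "e * prod_list (map ((*) e) bs) = e * prod_list bs" for bs
  proof (induction bs)
    case (Cons b bs)
    have "e * (e * b * prod_list (map ((*) e) bs)) = b * (e * e) * prod_list (map ((*) e) bs)"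
      by (metis ec mult.assoc)
    also have "\<dots> = b * (e * prod_list (map ((*) e) bs))"
      by (simp add: e(1) mult.assoc)
    also have "\<dots> = e * (b * prod_list bs)"
      unfolding Cons by (metis ec mult.assoc)
    finally show ?case by simp
  qed simp
  ultimately show False
    using as(2) by (metis mult_zero_right)
qed

lemma exists_homogeneous_units:
  obtains e u v where "e * e = e" "e \<noteq> 0" "\<And>r. e * r = r * e"
    "\<And>i. i \<in> {1..m} \<Longrightarrow> \<exists>x\<in>R i. u i = e * x"
    "\<And>i. i \<in> {1..m} \<Longrightarrow> u i * v i = e"
    "\<And>i. i \<in> {1..m} \<Longrightarrow> v i * u i = e"
    "\<And>i. i \<in> {1..m} \<Longrightarrow> e * v i = v i"
proof -
  obtain e where e: "e * e = e" "central e" "full e"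
    "\<And>f. f * f = f \<Longrightarrow> central f \<Longrightarrow> full f \<Longrightarrow> f * e = f \<Longrightarrow> f = e"
    using exists_minimal_full_idempotent by metis
  have "\<forall>i. \<exists>x y. i \<in> {1..m} \<longrightarrow> x \<in> R i \<and> e * x * y = e \<and> y * (e * x) = e \<and> e * y = y"
    using exists_homogeneous_unit[OF e] by blast
  then obtain x v where xv:
    "\<And>i. i \<in> {1..m} \<Longrightarrow> x i \<in> R i \<and> e * x i * v i = e \<and> v i * (e * x i) = e \<and> e * v i = v i"
    by metis
  have "e \<noteq> 0"
    using e(3) unfolding full_def by (metis empty_subsetI list.set(1) mult_zero_left)
  then show ?thesis
    using that[of e "\<lambda>i. e * x i" v] e(1,2) xv unfolding central_def by blast
qed

end

section \<open>Weights and the bicharacter\<close>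

text \<open>
  A matrix with more rows than columns has no right inverse; here for matrices indexed by arbitrary
  finite sets, by padding with zeros to square matrices and exchanging the two factors.
\<close>
lemma card_le_of_left_inverse:
  fixes X :: "'i \<Rightarrow> 'j \<Rightarrow> 'k::field" and Y :: "'j \<Rightarrow> 'i \<Rightarrow> 'k"
  assumes fin: "finite A" "finite B" and c: "c \<noteq> 0"
    and XY: "\<And>i i'. i \<in> A \<Longrightarrow> i' \<in> A \<Longrightarrow> (\<Sum>j\<in>B. X i j * Y j i') = (if i = i' then c else 0)"
  shows "card A \<le> card B"
proof (rule ccontr)
  assume "\<not> card A \<le> card B"
  then have less: "card B < card A" by simp
  define n where "n = card A"
  obtain a where a: "bij_betw a {0..<n} A"
    using ex_bij_betw_nat_finite[OF fin(1)] unfolding n_def by blast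
  obtain b where b: "bij_betw b {0..<card B} B"
    using ex_bij_betw_nat_finite[OF fin(2)] by blast
  define P where "P = mat n n (\<lambda>(i, j). if j < card B then X (a i) (b j) else 0)"
  define Q where "Q = mat n n (\<lambda>(i, j). if i < card B then Y (b i) (a j) / c else 0)"
  have PQ: "P \<in> carrier_mat n n" "Q \<in> carrier_mat n n"
    by (simp_all add: P_def Q_def)
  have "P * Q = 1\<^sub>m n"
  proof (rule eq_matI)
    fix i k assume "i < dim_row (1\<^sub>m n :: 'k mat)" "k < dim_col (1\<^sub>m n :: 'k mat)"
    then have ik: "i < n" "k < n" by simp_all
    then have mem: "a i \<in> A" "a k \<in> A"
      using a by (auto simp: bij_betw_def)
    have "(P * Q) $$ (i, k) =
        (\<Sum>j\<in>{0..<n}. (if j < card B then X (a i) (b j) * (Y (b j) (a k) / c) else 0))"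
      using ik by (auto simp: P_def Q_def scalar_prod_def intro!: sum.cong)
    also have "\<dots> = (\<Sum>j\<in>{0..<card B}. X (a i) (b j) * (Y (b j) (a k) / c))"
      using less unfolding n_def by (intro sum.mono_neutral_cong_right) auto
    also have "\<dots> = (\<Sum>j\<in>B. X (a i) j * (Y j (a k) / c))"
      by (rule sum.reindex_bij_betw[OF b])
    also have "\<dots> = (\<Sum>j\<in>B. X (a i) j * Y j (a k)) / c"
      by (simp add: sum_divide_distrib)
    also have "\<dots> = 1\<^sub>m n $$ (i, k)"
      using XY[OF mem] ik a c by (auto simp: bij_betw_def inj_on_def)
    finally show "(P * Q) $$ (i, k) = 1\<^sub>m n $$ (i, k)" .
  qed (use PQ in auto)
  then have QP: "Q * P = 1\<^sub>m n"
    using mat_mult_left_right_inverse[OF PQ] by blast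
  have last: "n - 1 < n" "\<not> n - 1 < card B"
    using less unfolding n_def by auto
  have "(Q * P) $$ (n - 1, n - 1) = 0"
    using last PQ by (auto simp: P_def Q_def scalar_prod_def)
  then show False
    using QP last(1) by simp
qed

text \<open>
  The assumption \<open>separated\<close> is minimality of the decomposition; the elements \<open>e\<close>, \<open>u\<close>, \<open>v\<close>
  are those provided by \<open>exists_homogeneous_units\<close>.
\<close>
locale regular_qc_units = regular_qc_algebra scale Basis m R \<theta>
  for scale :: "'k::field \<Rightarrow> 'a::ring_1 \<Rightarrow> 'a" (infixr \<open>*s\<close> 75) and Basis m R \<theta> +
  fixes e :: 'a and u v :: "nat \<Rightarrow> 'a"
  assumes e_idem: "e * e = e"
    and e_nonzero: "e \<noteq> 0"
    and e_central: "\<And>r. e * r = r * e"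
    and u_component: "\<And>i. i \<in> {1..m} \<Longrightarrow> \<exists>x\<in>R i. u i = e * x"
    and u_v: "\<And>i. i \<in> {1..m} \<Longrightarrow> u i * v i = e"
    and v_u: "\<And>i. i \<in> {1..m} \<Longrightarrow> v i * u i = e"
    and e_v: "\<And>i. i \<in> {1..m} \<Longrightarrow> e * v i = v i"
    and separated: "\<And>i j. i \<in> {1..m} \<Longrightarrow> j \<in> {1..m} \<Longrightarrow>
      (\<And>k. k \<in> {1..m} \<Longrightarrow> \<theta> k i = \<theta> k j) \<Longrightarrow> i = j"
begin

lemma e_e_mult [simp]: "e * (e * x) = e * x"
  by (simp add: mult.assoc[symmetric] e_idem)

lemma v_e: "i \<in> {1..m} \<Longrightarrow> v i * e = v i"
  using e_v e_central by metis

lemma e_u: "i \<in> {1..m} \<Longrightarrow> e * u i = u i"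
  using u_component[of i] by auto

lemma u_e: "i \<in> {1..m} \<Longrightarrow> u i * e = u i"
  using e_u e_central by metis

text \<open>
  Membership of \<open>x\<close> in the simultaneous eigenspace of weight \<open>\<chi>\<close> for the conjugations
  \<open>x \<mapsto> u k * x * v k\<close> of \<open>e R\<close>. The vector \<open>0\<close> has every weight.
\<close>
definition weight :: "(nat \<Rightarrow> 'k) \<Rightarrow> 'a \<Rightarrow> bool" where
  "weight \<chi> x \<longleftrightarrow> e * x = x \<and> (\<forall>k\<in>{1..m}. u k * x = \<chi> k *s (x * u k))"

lemma weight_e_mult: "weight \<chi> x \<Longrightarrow> e * x = x"
  by (simp add: weight_def)

lemma weight_mult_e: "weight \<chi> x \<Longrightarrow> x * e = x"
  using e_central unfolding weight_def by metis

lemma weightD: "weight \<chi> x \<Longrightarrow> k \<in> {1..m} \<Longrightarrow> u k * x = \<chi> k *s (x * u k)"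
  by (simp add: weight_def)

lemma weight_component:
  assumes "j \<in> {1..m}" "r \<in> R j"
  shows "weight (\<lambda>k. \<theta> k j) (e * r)"
  unfolding weight_def
proof (intro conjI ballI)
  fix k assume k: "k \<in> {1..m}"
  then obtain x where x: "x \<in> R k" "u k = e * x"
    using u_component by blast
  have "u k * (e * r) = e * (x * r)"
    unfolding x(2) using e_central[of x] by (metis e_e_mult mult.assoc)
  also have "\<dots> = \<theta> k j *s (e * (r * x))"
    by (simp add: component_commute[OF k assms(1) x(1) assms(2)] scale_mult_right)
  also have "e * (r * x) = e * r * u k"
    unfolding x(2) using e_central[of r] by (metis e_e_mult mult.assoc)
  finally show "u k * (e * r) = \<theta> k j *s (e * r * u k)" .
qed simp

lemma weight_u: "j \<in> {1..m} \<Longrightarrow> weight (\<lambda>k. \<theta> k j) (u j)"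
  using u_component weight_component by metis

lemma u_nonzero: "j \<in> {1..m} \<Longrightarrow> u j \<noteq> 0"
  using u_v e_nonzero by fastforce

lemma u_mult_nonzero:
  assumes "i \<in> {1..m}" "x \<noteq> 0" "e * x = x"
  shows "u i * x \<noteq> 0"
proof
  assume "u i * x = 0"
  then have "v i * u i * x = 0"
    by (simp add: mult.assoc)
  then show False
    using assms v_u by simp
qed

lemma theta_diag: "i \<in> {1..m} \<Longrightarrow> \<theta> i i = 1"
proof -
  assume i: "i \<in> {1..m}"
  have "1 *s (u i * u i) = \<theta> i i *s (u i * u i)"
    using weightD[OF weight_u[OF i] i] by simp
  moreover have "u i * u i \<noteq> 0"
    using i u_mult_nonzero u_nonzero e_u by blast
  ultimately show ?thesis
    by (metis scale_right_imp_eq)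
qed

lemma theta_swap:
  assumes i: "i \<in> {1..m}" and j: "j \<in> {1..m}"
  shows "\<theta> i j = inverse (\<theta> j i)"
proof -
  have "u i * u j = \<theta> i j *s (u j * u i)"
    using weightD[OF weight_u[OF j] i] .
  also have "u j * u i = \<theta> j i *s (u i * u j)"
    using weightD[OF weight_u[OF i] j] .
  finally have "1 *s (u i * u j) = (\<theta> i j * \<theta> j i) *s (u i * u j)"
    by simp
  moreover have "u i * u j \<noteq> 0"
    using i j u_mult_nonzero u_nonzero e_u by blast
  ultimately have "\<theta> i j * \<theta> j i = 1"
    by (metis scale_right_imp_eq)
  then show ?thesis
    by (metis inverse_unique mult.commute)
qed

lemma weight_mult:
  assumes "weight \<chi> x" "weight \<psi> y"
  shows "weight (\<lambda>k. \<chi> k * \<psi> k) (x * y)"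
  unfolding weight_def
proof (intro conjI ballI)
  show "e * (x * y) = x * y"
    using weight_e_mult[OF assms(1)] by (simp add: mult.assoc[symmetric])
  fix k assume k: "k \<in> {1..m}"
  have "u k * (x * y) = \<chi> k *s (x * (u k * y))"
    using weightD[OF assms(1) k] by (simp add: mult.assoc[symmetric] scale_mult_left)
  then show "u k * (x * y) = (\<chi> k * \<psi> k) *s (x * y * u k)"
    using weightD[OF assms(2) k] by (simp add: mult.assoc scale_mult_right)
qed

lemma weight_scale: "weight \<chi> x \<Longrightarrow> weight \<chi> (c *s x)"
  by (simp add: weight_def scale_mult_left scale_mult_right mult.commute)

lemma weight_v:
  assumes j: "j \<in> {1..m}"
  shows "weight (\<lambda>k. inverse (\<theta> k j)) (v j)"
  unfolding weight_def
proof (intro conjI ballI)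
  show "e * v j = v j" using e_v[OF j] .
  fix k assume k: "k \<in> {1..m}"
  have "u k * v j = v j * u j * u k * v j"
    by (simp add: v_u[OF j] e_u[OF k])
  also have "\<dots> = v j * (u j * u k) * v j"
    by (simp add: mult.assoc)
  also have "\<dots> = \<theta> j k *s (v j * u k * (u j * v j))"
    by (simp add: weightD[OF weight_u[OF k] j] scale_mult_left scale_mult_right mult.assoc)
  also have "\<dots> = inverse (\<theta> k j) *s (v j * u k)"
    by (simp add: u_v[OF j] mult.assoc u_e[OF k] theta_swap[OF j k])
  finally show "u k * v j = inverse (\<theta> k j) *s (v j * u k)" .
qed

text \<open>
  Eigenvectors for distinct weights are independent: to eliminate the term of index \<open>a\<close>, subtract
  \<open>\<chi> a k\<close> times the relation from its conjugate under \<open>u k\<close>, where \<open>k\<close> separates \<open>\<chi> a\<close> from the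
  weight under consideration.
\<close>
lemma weight_independent:
  assumes "finite L" "\<And>l. l \<in> L \<Longrightarrow> weight (\<chi> l) (x l)"
    "\<And>l l'. l \<in> L \<Longrightarrow> l' \<in> L \<Longrightarrow> l \<noteq> l' \<Longrightarrow> \<exists>k\<in>{1..m}. \<chi> l k \<noteq> \<chi> l' k"
    "(\<Sum>l\<in>L. x l) = 0"
  shows "\<forall>l\<in>L. x l = 0"
  using assms
proof (induction L arbitrary: x rule: finite_induct)
  case (insert a F)
  have "x l = 0" if l: "l \<in> F" for l
  proof -
    obtain k where k: "k \<in> {1..m}" "\<chi> l k \<noteq> \<chi> a k"
      using insert.prems(2)[of l a] l insert.hyps by blast
    have conj: "u k * x j * v k = \<chi> j k *s x j" if "j \<in> insert a F" for j
    proof -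
      have w: "weight (\<chi> j) (x j)"
        using insert.prems(1) that by blast
      have "u k * x j * v k = \<chi> j k *s (x j * (u k * v k))"
        using weightD[OF w k(1)] by (simp add: scale_mult_left mult.assoc)
      then show ?thesis
        using weight_mult_e[OF w] u_v[OF k(1)] by simp
    qed
    have "(\<Sum>j\<in>insert a F. \<chi> j k *s x j) = (\<Sum>j\<in>insert a F. u k * x j * v k)"
      using conj by (intro sum.cong) auto
    also have "\<dots> = u k * (\<Sum>j\<in>insert a F. x j) * v k"
      by (simp only: sum_distrib_left sum_distrib_right)
    finally have 1: "(\<Sum>j\<in>insert a F. \<chi> j k *s x j) = 0"
      using insert.prems(3) by simp
    have 2: "(\<Sum>j\<in>insert a F. \<chi> a k *s x j) = 0"
      using insert.prems(3) by (simp only: scale_sum_right[symmetric] scale_zero_right)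
    have "(\<Sum>j\<in>insert a F. (\<chi> j k - \<chi> a k) *s x j) = 0"
      using 1 2 by (simp only: scale_left_diff_distrib sum_subtractf) simp
    then have sum0: "(\<Sum>j\<in>F. (\<chi> j k - \<chi> a k) *s x j) = 0"
      using insert.hyps by simp
    have "\<forall>j\<in>F. (\<chi> j k - \<chi> a k) *s x j = 0"
    proof (rule insert.IH)
      show "weight (\<chi> j) ((\<chi> j k - \<chi> a k) *s x j)" if "j \<in> F" for j
        using insert.prems(1) that by (intro weight_scale) auto
      show "\<exists>k\<in>{1..m}. \<chi> j k \<noteq> \<chi> j' k" if "j \<in> F" "j' \<in> F" "j \<noteq> j'" for j j'
        using insert.prems(2)[of j j'] that by auto
    qed (fact sum0)
    then show ?thesis
      using l k(2) by auto
  qed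
  then show ?case
    using insert.prems(3) insert.hyps by simp
qed simp

lemma corner_components:
  obtains a where "\<And>i. i \<in> {1..m} \<Longrightarrow> \<exists>r\<in>R i. a i = e * r" "e * x = (\<Sum>i\<in>{1..m}. a i)"
proof -
  obtain b where b: "\<forall>i\<in>{1..m}. b i \<in> R i" "x = (\<Sum>i\<in>{1..m}. b i)"
    using components by blast
  show ?thesis
    by (rule that[of "\<lambda>i. e * b i"]) (use b in \<open>auto simp: sum_distrib_left\<close>)
qed

lemma separatedE:
  assumes "i \<in> {1..m}" "j \<in> {1..m}" "i \<noteq> j"
  obtains k where "k \<in> {1..m}" "\<theta> k i \<noteq> \<theta> k j"
  using separated assms by blast

text \<open>
  The components of \<open>x\<close> in \<open>e R\<close> have the weights \<open>k \<mapsto> \<theta> k l\<close>. A weight different from all of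
  these would make \<open>- x\<close> and the components of \<open>x\<close> a relation between distinct weights.
\<close>
lemma weight_occurs:
  assumes x: "weight \<chi> x" "x \<noteq> 0"
  obtains l where "l \<in> {1..m}" "\<And>k. k \<in> {1..m} \<Longrightarrow> \<theta> k l = \<chi> k"
proof -
  obtain a where a: "\<And>i. i \<in> {1..m} \<Longrightarrow> \<exists>r\<in>R i. a i = e * r" "e * x = (\<Sum>i\<in>{1..m}. a i)"
    using corner_components[of x] by blast
  have "\<exists>l\<in>{1..m}. \<forall>k\<in>{1..m}. \<theta> k l = \<chi> k"
  proof (rule ccontr)
    assume new: "\<not> ?thesis"
    \<comment> \<open>The index \<open>0\<close>, outside of the index set, carries the extra vector \<open>- x\<close>.\<close>
    define X where "X l = (if l = 0 then (- 1) *s x else a l)" for l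
    define \<psi> where "\<psi> l k = (if l = 0 then \<chi> k else \<theta> k l)" for l k
    have "\<forall>l\<in>insert 0 {1..m}. X l = 0"
    proof (rule weight_independent[where \<chi> = \<psi>])
      show "weight (\<psi> l) (X l)" if "l \<in> insert 0 {1..m}" for l
      proof (cases "l = 0")
        case True
        then show ?thesis
          unfolding \<psi>_def X_def using weight_scale[OF x(1), of "- 1"] by simp
      next
        case False
        then have l: "l \<in> {1..m}" using that by simp
        then obtain r where "r \<in> R l" "a l = e * r" using a(1) by blast
        then show ?thesis
          unfolding \<psi>_def X_def using weight_component[OF l] False by simp
      qed
      show "\<exists>k\<in>{1..m}. \<psi> l k \<noteq> \<psi> l' k"
        if ll: "l \<in> insert 0 {1..m}" "l' \<in> insert 0 {1..m}" "l \<noteq> l'" for l l'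
      proof (cases "l = 0 \<or> l' = 0")
        case True
        then consider "l = 0" "l' \<in> {1..m}" | "l' = 0" "l \<in> {1..m}"
          using ll by blast
        then show ?thesis
        proof cases
          case 1
          then obtain k where "k \<in> {1..m}" "\<theta> k l' \<noteq> \<chi> k"
            using new by blast
          moreover have "l' \<noteq> 0" using 1 by simp
          ultimately show ?thesis
            using 1 unfolding \<psi>_def by (intro bexI[of _ k]) auto
        next
          case 2
          then obtain k where "k \<in> {1..m}" "\<theta> k l \<noteq> \<chi> k"
            using new by blast
          moreover have "l \<noteq> 0" using 2 by simp
          ultimately show ?thesis
            using 2 unfolding \<psi>_def by (intro bexI[of _ k]) auto
        qed
      next
        case False
        then obtain k where "k \<in> {1..m}" "\<theta> k l \<noteq> \<theta> k l'"
          using separatedE[of l l'] ll by blast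
        then show ?thesis
          using False unfolding \<psi>_def by (intro bexI[of _ k]) simp_all
      qed
      show "(\<Sum>l\<in>insert 0 {1..m}. X l) = 0"
      proof -
        have "(\<Sum>l\<in>{1..m}. X l) = (\<Sum>l\<in>{1..m}. a l)"
          by (rule sum.cong) (auto simp: X_def)
        then show ?thesis
          using a(2) weight_e_mult[OF x(1)] by (simp add: X_def)
      qed
    qed simp
    then have "X 0 = 0" by blast
    then show False
      using x(2) by (simp add: X_def)
  qed
  then show ?thesis using that by blast
qed

lemma component_zero_if_commutes:
  assumes a: "\<And>i. i \<in> {1..m} \<Longrightarrow> \<exists>r\<in>R i. a i = e * r"
    and h: "h \<in> {1..m}" and comm: "u h * (\<Sum>i\<in>{1..m}. a i) = (\<Sum>i\<in>{1..m}. a i) * u h"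
    and l: "l \<in> {1..m}" "\<theta> h l \<noteq> 1"
  shows "a l = 0"
proof -
  have w: "weight (\<lambda>k. \<theta> k i) (a i)" if "i \<in> {1..m}" for i
    using a[OF that] weight_component[OF that] by auto
  have "\<forall>i\<in>{1..m}. (\<theta> h i - 1) *s a i = 0"
  proof (rule weight_independent[where \<chi> = "\<lambda>i k. \<theta> k i"])
    show "weight (\<lambda>k. \<theta> k i) ((\<theta> h i - 1) *s a i)" if "i \<in> {1..m}" for i
      using w[OF that] by (rule weight_scale)
    show "\<exists>k\<in>{1..m}. \<theta> k i \<noteq> \<theta> k j" if "i \<in> {1..m}" "j \<in> {1..m}" "i \<noteq> j" for i j
      using separatedE[OF that] by blast
    have "(\<theta> h i - 1) *s a i = (u h * a i - a i * u h) * v h" if "i \<in> {1..m}" for i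
    proof -
      have "u h * a i * v h = \<theta> h i *s a i" "a i * u h * v h = a i"
        using weightD[OF w[OF that] h] weight_mult_e[OF w[OF that]]
        by (simp_all add: scale_mult_left mult.assoc u_v[OF h])
      then show ?thesis
        by (simp add: left_diff_distrib scale_left_diff_distrib)
    qed
    then have "(\<Sum>i\<in>{1..m}. (\<theta> h i - 1) *s a i) = (\<Sum>i\<in>{1..m}. (u h * a i - a i * u h) * v h)"
      by (intro sum.cong) auto
    also have "\<dots> = (u h * (\<Sum>i\<in>{1..m}. a i) - (\<Sum>i\<in>{1..m}. a i) * u h) * v h"
      by (simp only: sum_distrib_left sum_distrib_right sum_subtractf left_diff_distrib)
    finally show "(\<Sum>i\<in>{1..m}. (\<theta> h i - 1) *s a i) = 0"
      using comm by simp
  qed simp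
  then show ?thesis
    using l by auto
qed

text \<open>
  The group law on the index set \<open>{1..m}\<close> that corresponds to the pointwise product of columns.
\<close>
definition mul :: "nat \<Rightarrow> nat \<Rightarrow> nat" where
  "mul i j = (SOME l. l \<in> {1..m} \<and> (\<forall>k\<in>{1..m}. \<theta> k l = \<theta> k i * \<theta> k j))"

lemma
  assumes i: "i \<in> {1..m}" and j: "j \<in> {1..m}"
  shows mul_closed: "mul i j \<in> {1..m}"
    and theta_mul_right: "k \<in> {1..m} \<Longrightarrow> \<theta> k (mul i j) = \<theta> k i * \<theta> k j"
proof -
  have "u i * u j \<noteq> 0"
    using i j u_mult_nonzero u_nonzero e_u by blast
  then have "\<exists>l. l \<in> {1..m} \<and> (\<forall>k\<in>{1..m}. \<theta> k l = \<theta> k i * \<theta> k j)"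
    using weight_occurs[OF weight_mult[OF weight_u[OF i] weight_u[OF j]]] by metis
  then have "mul i j \<in> {1..m} \<and> (\<forall>k\<in>{1..m}. \<theta> k (mul i j) = \<theta> k i * \<theta> k j)"
    unfolding mul_def by (rule someI_ex)
  then show "mul i j \<in> {1..m}" and "k \<in> {1..m} \<Longrightarrow> \<theta> k (mul i j) = \<theta> k i * \<theta> k j"
    by blast+
qed

lemma theta_mul_left:
  assumes "i \<in> {1..m}" "j \<in> {1..m}" "k \<in> {1..m}"
  shows "\<theta> (mul i j) k = \<theta> i k * \<theta> j k"
  unfolding theta_swap[OF mul_closed[OF assms(1,2)] assms(3)] theta_mul_right[OF assms]
    theta_swap[OF assms(1,3)] theta_swap[OF assms(2,3)] by simp

text \<open>
  The weight of \<open>v i * u j\<close> is the quotient of columns \<open>j\<close> and \<open>i\<close>. This provides all the division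
  in the group that the counting arguments need.
\<close>
lemma obtain_quotient:
  assumes i: "i \<in> {1..m}" and j: "j \<in> {1..m}"
  obtains l where "l \<in> {1..m}" "\<And>k. k \<in> {1..m} \<Longrightarrow> \<theta> k l = inverse (\<theta> k i) * \<theta> k j"
proof -
  have "v i * u j \<noteq> 0"
  proof
    assume "v i * u j = 0"
    then have "u i * v i * u j = 0" by (simp add: mult.assoc)
    then show False
      using u_v[OF i] e_u[OF j] u_nonzero[OF j] by simp
  qed
  then show ?thesis
    using weight_occurs[OF weight_mult[OF weight_v[OF i] weight_u[OF j]]] that by blast
qed

lemma mul_left_cancel:
  assumes "mul k i = mul k j" "i \<in> {1..m}" "j \<in> {1..m}" "k \<in> {1..m}"
  shows "i = j"
proof (rule separated)
  fix l assume l: "l \<in> {1..m}"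
  have "\<theta> l k * \<theta> l i = \<theta> l k * \<theta> l j"
    using assms theta_mul_right l by metis
  then show "\<theta> l i = \<theta> l j"
    using theta_nonzero[OF l assms(4)] by simp
qed (use assms in auto)

text \<open>
  Translating by \<open>k\<close> permutes \<open>X\<close> and multiplies the sum by \<open>\<theta> k l \<noteq> 1\<close>.
\<close>
lemma sum_nontrivial_character:
  assumes X: "finite X" "X \<subseteq> {1..m}" "\<And>x. x \<in> X \<Longrightarrow> mul k x \<in> X"
    and k: "k \<in> {1..m}" and l: "l \<in> {1..m}" "\<theta> k l \<noteq> 1"
  shows "(\<Sum>x\<in>X. \<theta> x l) = 0"
proof -
  have "inj_on (mul k) X"
    using mul_left_cancel X(2) k by (auto intro!: inj_onI simp: subset_iff)
  moreover have "mul k ` X \<subseteq> X"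
    using X(3) by blast
  ultimately have "bij_betw (mul k) X X"
    using X(1) by (simp add: bij_betw_def endo_inj_surj)
  then have "(\<Sum>x\<in>X. \<theta> x l) = (\<Sum>x\<in>X. \<theta> (mul k x) l)"
    by (rule sum.reindex_bij_betw[symmetric])
  also have "\<dots> = \<theta> k l * (\<Sum>x\<in>X. \<theta> x l)"
    unfolding sum_distrib_left using X(2) k l(1) by (intro sum.cong) (auto intro!: theta_mul_left)
  finally show ?thesis
    using l(2) by (metis mult_cancel_right1)
qed

text \<open>
  Since \<open>\<theta> i x\<close> is the inverse of \<open>\<theta> x i\<close>, the summand is the value at \<open>x\<close> of the character
  that is the quotient of columns \<open>j\<close> and \<open>i\<close>.
\<close>
lemma orthogonality_on:
  assumes X: "finite X" "X \<subseteq> {1..m}" "\<And>x y. x \<in> X \<Longrightarrow> y \<in> X \<Longrightarrow> mul x y \<in> X"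
    and ij: "i \<in> {1..m}" "j \<in> {1..m}"
    and dist: "i \<noteq> j \<Longrightarrow> \<exists>x\<in>X. \<theta> x i \<noteq> \<theta> x j"
  shows "(\<Sum>x\<in>X. \<theta> i x * \<theta> x j) = (if i = j then of_nat (card X) else 0)"
proof -
  obtain l where l: "l \<in> {1..m}" "\<And>k. k \<in> {1..m} \<Longrightarrow> \<theta> k l = inverse (\<theta> k i) * \<theta> k j"
    using obtain_quotient ij by blast
  have "(\<Sum>x\<in>X. \<theta> i x * \<theta> x j) = (\<Sum>x\<in>X. \<theta> x l)"
  proof (rule sum.cong[OF refl])
    fix x assume "x \<in> X"
    then have "x \<in> {1..m}" using X(2) by blast
    then show "\<theta> i x * \<theta> x j = \<theta> x l"
      using theta_swap[OF ij(1), of x] l(2) by simp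
  qed
  also have "\<dots> = (if i = j then of_nat (card X) else 0)"
  proof (cases "i = j")
    case True
    have "(\<Sum>x\<in>X. \<theta> x l) = (\<Sum>x\<in>X. 1)"
    proof (rule sum.cong[OF refl])
      fix x assume "x \<in> X"
      then have "x \<in> {1..m}" using X(2) by blast
      then show "\<theta> x l = 1"
        using theta_nonzero[OF _ ij(2), of x] l(2) True by simp
    qed
    then show ?thesis using True by simp
  next
    case False
    then obtain x where x: "x \<in> X" "\<theta> x i \<noteq> \<theta> x j"
      using dist by blast
    then have xm: "x \<in> {1..m}" using X(2) by blast
    then have "\<theta> x l \<noteq> 1"
      using l(2)[OF xm] x(2) theta_nonzero[OF xm ij(1)] by (auto simp: field_simps)
    then show ?thesis
      using sum_nontrivial_character[OF X(1,2) _ xm l(1)] X(3) x(1) False by simp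
  qed
  finally show ?thesis .
qed

lemma orthogonality:
  assumes "i \<in> {1..m}" "j \<in> {1..m}"
  shows "(\<Sum>k\<in>{1..m}. \<theta> i k * \<theta> k j) = (if i = j then of_nat m else 0)"
proof -
  have "\<exists>x\<in>{1..m}. \<theta> x i \<noteq> \<theta> x j" if "i \<noteq> j"
    using separatedE[OF assms that] by blast
  then show ?thesis
    using orthogonality_on[of "{1..m}" i j] assms mul_closed by simp
qed

section \<open>Lagrangian subgroups and their cosets\<close>

text \<open>
  Equality with the orthogonal complement makes \<open>H\<close> a subgroup for free.
\<close>
definition lagrangian :: "nat set \<Rightarrow> bool" where
  "lagrangian H \<longleftrightarrow> H = {g \<in> {1..m}. \<forall>h\<in>H. \<theta> g h = 1}"

text \<open>
  Take an isotropic set of maximal cardinality. An element orthogonal to it can be added to it,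
  because every element is orthogonal to itself (\<open>theta_diag\<close>), so it already belongs to it.
\<close>
lemma exists_lagrangian: "\<exists>H. lagrangian H"
proof -
  define P where "P H \<longleftrightarrow> H \<subseteq> {1..m} \<and> (\<forall>g\<in>H. \<forall>h\<in>H. \<theta> g h = 1)" for H
  have "P {}" by (simp add: P_def)
  moreover have "card H < Suc m" if "P H" for H
    using that card_mono[of "{1..m}" H] by (simp add: P_def)
  ultimately obtain H where H: "P H" and max: "\<And>H'. P H' \<Longrightarrow> card H' \<le> card H"
    using ex_has_greatest_nat[of P "{}" card "Suc m"] by auto
  have fin: "finite H"
    using H finite_subset unfolding P_def by blast
  have "g \<in> H" if g: "g \<in> {1..m}" "\<forall>h\<in>H. \<theta> g h = 1" for g
  proof (rule ccontr)
    assume "g \<notin> H"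
    have "\<theta> h g = 1" if "h \<in> H" for h
      using theta_swap[of h g] H g that unfolding P_def by auto
    then have "P (insert g H)"
      using H g theta_diag unfolding P_def by auto
    then show False
      using max[of "insert g H"] fin \<open>g \<notin> H\<close> by simp
  qed
  moreover have "g \<in> {1..m}" "\<forall>h\<in>H. \<theta> g h = 1" if "g \<in> H" for g
    using H that unfolding P_def by blast+
  ultimately have "H = {g \<in> {1..m}. \<forall>h\<in>H. \<theta> g h = 1}"
    by blast
  then show ?thesis
    unfolding lagrangian_def by blast
qed

text \<open>
  For Lagrangian \<open>H\<close>, two indices lie in the same coset of \<open>H\<close> exactly if they restrict to the same
  character of \<open>H\<close>. The definition takes the latter description, which avoids forming quotients.
\<close>
definition coset_representatives :: "nat set \<Rightarrow> nat set \<Rightarrow> bool" where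
  "coset_representatives H T \<longleftrightarrow> T \<subseteq> {1..m} \<and>
     (\<forall>s\<in>T. \<forall>t\<in>T. s \<noteq> t \<longrightarrow> (\<exists>h\<in>H. \<theta> h s \<noteq> \<theta> h t)) \<and>
     (\<forall>g\<in>{1..m}. \<exists>t\<in>T. \<forall>h\<in>H. \<theta> h g = \<theta> h t)"

lemma exists_coset_representatives: "\<exists>T. coset_representatives H T"
proof -
  define P where "P T \<longleftrightarrow> T \<subseteq> {1..m} \<and>
     (\<forall>s\<in>T. \<forall>t\<in>T. s \<noteq> t \<longrightarrow> (\<exists>h\<in>H. \<theta> h s \<noteq> \<theta> h t))" for T
  have "P {}" by (simp add: P_def)
  moreover have "card T < Suc m" if "P T" for T
    using that card_mono[of "{1..m}" T] by (simp add: P_def)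
  ultimately obtain T where T: "P T" and max: "\<And>T'. P T' \<Longrightarrow> card T' \<le> card T"
    using ex_has_greatest_nat[of P "{}" card "Suc m"] by auto
  have fin: "finite T"
    using T finite_subset unfolding P_def by blast
  have total: "\<exists>t\<in>T. \<forall>h\<in>H. \<theta> h g = \<theta> h t" if g: "g \<in> {1..m}" for g
  proof (rule ccontr)
    assume new: "\<not> ?thesis"
    then have "g \<notin> T" by blast
    have "P (insert g T)"
      using T g new unfolding P_def by (metis insert_iff insert_subset)
    then show False
      using max[of "insert g T"] fin \<open>g \<notin> T\<close> by simp
  qed
  have "coset_representatives H T"
    unfolding coset_representatives_def
    using T total unfolding P_def by (intro conjI ballI) simp_all
  then show ?thesis ..
qed

context
  fixes H T
  assumes H: "lagrangian H" and T: "coset_representatives H T"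
begin

lemma lagrangian_subset: "H \<subseteq> {1..m}"
  using H unfolding lagrangian_def by blast

lemma lagrangian_isotropic: "g \<in> H \<Longrightarrow> h \<in> H \<Longrightarrow> \<theta> g h = 1"
  using H unfolding lagrangian_def by blast

lemma lagrangianI: "g \<in> {1..m} \<Longrightarrow> (\<And>h. h \<in> H \<Longrightarrow> \<theta> h g = 1) \<Longrightarrow> g \<in> H"
proof -
  assume g: "g \<in> {1..m}" and comm: "\<And>h. h \<in> H \<Longrightarrow> \<theta> h g = 1"
  have "\<theta> g h = 1" if "h \<in> H" for h
  proof -
    have "h \<in> {1..m}" using that lagrangian_subset by blast
    then show ?thesis
      using theta_swap[OF g] comm[OF that] by simp
  qed
  then have "g \<in> {g \<in> {1..m}. \<forall>h\<in>H. \<theta> g h = 1}"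
    using g by blast
  then show "g \<in> H"
    using H unfolding lagrangian_def by blast
qed

lemma lagrangian_mul: "g \<in> H \<Longrightarrow> h \<in> H \<Longrightarrow> mul g h \<in> H"
proof (rule lagrangianI)
  assume gh: "g \<in> H" "h \<in> H"
  then have "g \<in> {1..m}" "h \<in> {1..m}"
    using lagrangian_subset by blast+
  then show "mul g h \<in> {1..m}" by (rule mul_closed)
  fix k assume k: "k \<in> H"
  then have "k \<in> {1..m}"
    using lagrangian_subset by blast
  then show "\<theta> k (mul g h) = 1"
    using theta_mul_right[OF \<open>g \<in> {1..m}\<close> \<open>h \<in> {1..m}\<close>] lagrangian_isotropic[OF k] gh by simp
qed

lemma representatives_subset: "T \<subseteq> {1..m}"
  using T unfolding coset_representatives_def by blast

lemma representatives_separated: "s \<in> T \<Longrightarrow> t \<in> T \<Longrightarrow> s \<noteq> t \<Longrightarrow> \<exists>h\<in>H. \<theta> h s \<noteq> \<theta> h t"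
  using T unfolding coset_representatives_def by blast

lemma bij_betw_cosets: "bij_betw (\<lambda>(t, h). mul t h) (T \<times> H) {1..m}"
proof -
  have restrict: "\<theta> k (mul t h) = \<theta> k t" if "t \<in> T" "h \<in> H" "k \<in> H" for t h k
    using that lagrangian_isotropic[of k h] lagrangian_subset representatives_subset
    by (simp add: theta_mul_right subset_iff)
  have "inj_on (\<lambda>(t, h). mul t h) (T \<times> H)"
  proof (rule inj_onI, clarsimp)
    fix t h t' h' assume m: "t \<in> T" "h \<in> H" "t' \<in> T" "h' \<in> H" and eq: "mul t h = mul t' h'"
    have "t = t'"
      using representatives_separated[OF m(1,3)] restrict m eq by metis
    moreover have "h \<in> {1..m}" "h' \<in> {1..m}" "t \<in> {1..m}"
      using m lagrangian_subset representatives_subset by auto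
    ultimately show "t = t' \<and> h = h'"
      using mul_left_cancel eq by blast
  qed
  moreover have "(\<lambda>(t, h). mul t h) ` (T \<times> H) = {1..m}"
  proof
    show "(\<lambda>(t, h). mul t h) ` (T \<times> H) \<subseteq> {1..m}"
    proof clarify
      fix t h assume "t \<in> T" "h \<in> H"
      then show "mul t h \<in> {1..m}"
        using mul_closed lagrangian_subset representatives_subset by blast
    qed
    show "{1..m} \<subseteq> (\<lambda>(t, h). mul t h) ` (T \<times> H)"
    proof
      fix g assume g: "g \<in> {1..m}"
      then obtain t where t: "t \<in> T" "\<forall>h\<in>H. \<theta> h g = \<theta> h t"
        using T unfolding coset_representatives_def by blast
      then have tm: "t \<in> {1..m}"
        using representatives_subset by blast
      obtain l where l: "l \<in> {1..m}" "\<And>k. k \<in> {1..m} \<Longrightarrow> \<theta> k l = inverse (\<theta> k t) * \<theta> k g"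
        using obtain_quotient[OF tm g] by blast
      have "l \<in> H"
      proof (rule lagrangianI[OF l(1)])
        fix h assume h: "h \<in> H"
        then have hm: "h \<in> {1..m}" using lagrangian_subset by blast
        show "\<theta> h l = 1"
          using l(2)[OF hm] bspec[OF t(2) h] theta_nonzero[OF hm tm] by simp
      qed
      moreover have "mul t l = g"
      proof (rule separated)
        fix k assume k: "k \<in> {1..m}"
        show "\<theta> k (mul t l) = \<theta> k g"
          using theta_mul_right[OF tm l(1) k] l(2)[OF k] theta_nonzero[OF k tm] by simp
      qed (use mul_closed tm l(1) g in auto)
      ultimately show "g \<in> (\<lambda>(t, h). mul t h) ` (T \<times> H)"
        using t(1) by force
    qed
  qed
  ultimately show ?thesis
    by (simp add: bij_betw_def)
qed

lemma finite_H_T: "finite H" "finite T"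
  using lagrangian_subset representatives_subset finite_subset by blast+

lemma card_product: "m = card T * card H"
  using bij_betw_same_card[OF bij_betw_cosets] by (simp add: card_cartesian_product)

text \<open>
  The square matrix \<open>M\<close> restricts to a matrix \<open>T \<times> H\<close> and a matrix \<open>H \<times> T\<close>. Orthogonality over \<open>H\<close>
  shows that their product in one order is \<open>card H\<close> times the identity; orthogonality over the whole
  group, whose sums are \<open>card H\<close> times sums over \<open>T\<close>, shows that \<open>card H\<close> times their product in the
  other order is \<open>m\<close> times the identity. As \<open>m\<close> and its divisor \<open>card H\<close> are nonzero in \<open>K\<close>,
  comparing ranks gives both inequalities.
\<close>
lemma card_representatives:
  assumes m: "of_nat m \<noteq> (0 :: 'k)"
  shows "card T = card H"
proof (rule antisym)
  have nonzero: "of_nat (card H) \<noteq> (0 :: 'k)"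
    using m by (subst (asm) card_product) auto
  have sub: "s \<in> {1..m}" if "s \<in> T \<or> s \<in> H" for s
    using that lagrangian_subset representatives_subset by blast
  show "card T \<le> card H"
  proof (rule card_le_of_left_inverse[where c = "of_nat (card H)" and X = \<theta> and Y = \<theta>])
    fix s t assume st: "s \<in> T" "t \<in> T"
    show "(\<Sum>h\<in>H. \<theta> s h * \<theta> h t) = (if s = t then of_nat (card H) else 0)"
      using st sub representatives_separated[of s t]
      by (intro orthogonality_on finite_H_T lagrangian_subset lagrangian_mul) auto
  qed (use finite_H_T nonzero in auto)
  show "card H \<le> card T"
  proof (rule card_le_of_left_inverse[where c = "of_nat m" and X = "\<lambda>g t. of_nat (card H) * \<theta> g t" and Y = \<theta>])
    fix g h assume gh: "g \<in> H" "h \<in> H"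
    have "(if g = h then of_nat m else 0) = (\<Sum>k\<in>{1..m}. \<theta> g k * \<theta> k h)"
      using orthogonality gh sub by simp
    also have "\<dots> = (\<Sum>(t, k)\<in>T \<times> H. \<theta> g (mul t k) * \<theta> (mul t k) h)"
      using sum.reindex_bij_betw[OF bij_betw_cosets, symmetric] by (simp add: case_prod_unfold)
    also have "\<dots> = (\<Sum>(t, k)\<in>T \<times> H. \<theta> g t * \<theta> t h)"
    proof (intro sum.cong refl, clarsimp)
      fix t k assume "t \<in> T" "k \<in> H"
      then show "\<theta> g (mul t k) * \<theta> (mul t k) h = \<theta> g t * \<theta> t h"
        using gh sub lagrangian_isotropic[of g k] lagrangian_isotropic[of k h]
        by (simp add: theta_mul_left theta_mul_right)
    qed
    also have "\<dots> = (\<Sum>t\<in>T. of_nat (card H) * \<theta> g t * \<theta> t h)"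
      by (simp add: sum.cartesian_product[symmetric] mult.assoc)
    finally show "(\<Sum>t\<in>T. of_nat (card H) * \<theta> g t * \<theta> t h) = (if g = h then of_nat m else 0)"
      by simp
  qed (use finite_H_T m in auto)
qed

end

end

section \<open>Matrix units span simple subalgebras\<close>

context unital_algebra
begin

definition unit_span :: "'i set \<Rightarrow> ('i \<Rightarrow> 'i \<Rightarrow> 'a) \<Rightarrow> 'a set" where
  "unit_span T E = span ((\<lambda>(s, t). E s t) ` (T \<times> T))"

context
  fixes T :: "'i set" and E :: "'i \<Rightarrow> 'i \<Rightarrow> 'a"
  assumes finite_T: "finite T" and T_nonempty: "T \<noteq> {}"
    and E_mult: "\<And>s t s' t'. s \<in> T \<Longrightarrow> t \<in> T \<Longrightarrow> s' \<in> T \<Longrightarrow> t' \<in> T \<Longrightarrow>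
      E s t * E s' t' = (if t = s' then E s t' else 0)"
    and E_nonzero: "\<And>s t. s \<in> T \<Longrightarrow> t \<in> T \<Longrightarrow> E s t \<noteq> 0"
begin

lemma unit_in_span: "s \<in> T \<Longrightarrow> t \<in> T \<Longrightarrow> E s t \<in> unit_span T E"
  unfolding unit_span_def by (intro span_base) auto

lemma unit_mult_combination:
  assumes "s \<in> T" "t \<in> T"
  shows "E s t * (\<Sum>p\<in>T. \<Sum>q\<in>T. c p q *s E p q) = (\<Sum>q\<in>T. c t q *s E s q)"
proof -
  have "E s t * (\<Sum>p\<in>T. \<Sum>q\<in>T. c p q *s E p q) =
      (\<Sum>p\<in>T. if t = p then \<Sum>q\<in>T. c t q *s E s q else 0)"
    unfolding sum_distrib_left
    by (intro sum.cong refl) (auto simp: scale_mult_right E_mult assms intro!: sum.neutral sum.cong)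
  then show ?thesis
    using assms finite_T by simp
qed

lemma combination_mult_unit:
  assumes "s \<in> T" "t \<in> T"
  shows "(\<Sum>p\<in>T. \<Sum>q\<in>T. c p q *s E p q) * E s t = (\<Sum>p\<in>T. c p s *s E p t)"
proof -
  have "(\<Sum>p\<in>T. \<Sum>q\<in>T. c p q *s E p q) * E s t =
      (\<Sum>p\<in>T. \<Sum>q\<in>T. if q = s then c p s *s E p t else 0)"
    unfolding sum_distrib_right
    by (intro sum.cong refl) (auto simp: scale_mult_left E_mult assms)
  then show ?thesis
    using assms finite_T by simp
qed

text \<open>
  Multiplication by units on both sides isolates a single coefficient. This yields both the linear
  independence of the units and the fact that a nonzero ideal contains all of them.
\<close>
lemma coefficient_extraction:
  assumes "p \<in> T" "q \<in> T" "s \<in> T" "t \<in> T"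
  shows "E p s * (\<Sum>a\<in>T. \<Sum>b\<in>T. c a b *s E a b) * E t q = c s t *s E p q"
proof -
  have "(\<Sum>b\<in>T. c s b *s E p b) * E t q = (\<Sum>b\<in>T. if b = t then c s t *s E p q else 0)"
    unfolding sum_distrib_right
    by (intro sum.cong refl) (auto simp: scale_mult_left E_mult assms)
  then show ?thesis
    using assms finite_T by (simp add: unit_mult_combination)
qed

lemma inj_on_units: "inj_on (\<lambda>(s, t). E s t) (T \<times> T)"
proof (rule inj_onI, clarsimp)
  fix s t s' t' assume m: "s \<in> T" "t \<in> T" "s' \<in> T" "t' \<in> T" and eq: "E s t = E s' t'"
  have "E s s * E s' t' * E t t = E s t"
    using m eq[symmetric] by (simp add: E_mult)
  then have "E s s * E s' t' * E t t \<noteq> 0"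
    using E_nonzero m by simp
  then show "s = s' \<and> t = t'"
    using m by (auto simp: E_mult split: if_splits)
qed

lemma sum_units:
  "(\<Sum>x\<in>(\<lambda>(s, t). E s t) ` (T \<times> T). g x *s x) = (\<Sum>s\<in>T. \<Sum>t\<in>T. g (E s t) *s E s t)"
  by (subst sum.reindex[OF inj_on_units])
    (simp add: case_prod_unfold sum.cartesian_product)

lemma unit_spanE:
  assumes "x \<in> unit_span T E"
  obtains c where "x = (\<Sum>s\<in>T. \<Sum>t\<in>T. c s t *s E s t)"
proof -
  have "finite ((\<lambda>(s, t). E s t) ` (T \<times> T))"
    using finite_T by simp
  then obtain g where "x = (\<Sum>y\<in>(\<lambda>(s, t). E s t) ` (T \<times> T). g y *s y)"
    using assms unfolding unit_span_def by (auto simp: span_finite)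
  then show ?thesis
    using that[of "\<lambda>s t. g (E s t)"] by (simp add: sum_units)
qed

lemma dim_unit_span: "dim (unit_span T E) = card T * card T"
proof -
  let ?S = "(\<lambda>(s, t). E s t) ` (T \<times> T)"
  have "independent ?S"
  proof (rule independent_if_scalars_zero)
    show "finite ?S" using finite_T by simp
    fix g x assume sum0: "(\<Sum>x\<in>?S. g x *s x) = 0" and "x \<in> ?S"
    then obtain s t where x: "s \<in> T" "t \<in> T" "x = E s t" by auto
    have "g x *s E s t = E s s * (\<Sum>x\<in>?S. g x *s x) * E t t"
      unfolding sum_units x(3) using coefficient_extraction[of s t s t "\<lambda>s t. g (E s t)"] x by simp
    then show "g x = 0"
      using sum0 E_nonzero x by simp
  qed
  then have "dim (unit_span T E) = card ?S"
    unfolding unit_span_def by (rule dim_span_eq_card_independent)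
  also have "\<dots> = card T * card T"
    by (simp add: card_image[OF inj_on_units] card_cartesian_product)
  finally show ?thesis .
qed

lemma unit_span_combination: "(\<And>s t. s \<in> T \<Longrightarrow> t \<in> T \<Longrightarrow> y s t \<in> unit_span T E) \<Longrightarrow>
    (\<Sum>s\<in>T. \<Sum>t\<in>T. c s t *s y s t) \<in> unit_span T E"
  unfolding unit_span_def by (intro span_sum span_scale)

lemma simple_subalgebra_unit_span: "simple_subalgebra (unit_span T E)"
  unfolding simple_subalgebra_def subalgebra_def
proof (intro conjI ballI allI impI)
  show "subspace (unit_span T E)"
    unfolding unit_span_def by (rule subspace_span)
  show "x * y \<in> unit_span T E" if xy: "x \<in> unit_span T E" "y \<in> unit_span T E" for x y
  proof -
    obtain c where c: "x = (\<Sum>s\<in>T. \<Sum>t\<in>T. c s t *s E s t)" using unit_spanE xy(1) .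
    obtain d where d: "y = (\<Sum>s\<in>T. \<Sum>t\<in>T. d s t *s E s t)" using unit_spanE xy(2) .
    have Ey: "E s t * y \<in> unit_span T E" if "s \<in> T" "t \<in> T" for s t
      unfolding d using that unit_in_span
      by (simp add: unit_mult_combination) (auto simp: unit_span_def intro!: span_sum span_scale)
    have "x * y = (\<Sum>s\<in>T. \<Sum>t\<in>T. c s t *s (E s t * y))"
      by (simp add: c sum_distrib_right scale_mult_left)
    then show ?thesis
      using unit_span_combination[of "\<lambda>s t. E s t * y" c] Ey by simp
  qed
  show "\<exists>i\<in>unit_span T E. \<forall>x\<in>unit_span T E. i * x = x \<and> x * i = x"
  proof (intro bexI[of _ "\<Sum>s\<in>T. E s s"] ballI)
    show "(\<Sum>s\<in>T. E s s) \<in> unit_span T E"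
      using unit_in_span unfolding unit_span_def by (intro span_sum) auto
    fix x assume "x \<in> unit_span T E"
    then obtain c where c: "x = (\<Sum>s\<in>T. \<Sum>t\<in>T. c s t *s E s t)" using unit_spanE by blast
    have "(\<Sum>s\<in>T. E s s) * x = x"
      unfolding sum_distrib_right unfolding c by (simp add: unit_mult_combination)
    moreover have "x * (\<Sum>s\<in>T. E s s) = (\<Sum>t\<in>T. \<Sum>s\<in>T. c s t *s E s t)"
      unfolding sum_distrib_left unfolding c by (simp add: combination_mult_unit)
    moreover have "\<dots> = x"
      unfolding c by (rule sum.swap)
    ultimately show "(\<Sum>s\<in>T. E s s) * x = x \<and> x * (\<Sum>s\<in>T. E s s) = x"
      by simp
  qed
  show "unit_span T E \<noteq> {0}"
    using T_nonempty unit_in_span E_nonzero by (metis all_not_in_conv singletonD)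
  show "I = {0} \<or> I = unit_span T E" if I: "two_sided_ideal_of I (unit_span T E)" for I
  proof (cases "I \<subseteq> {0}")
    case True
    then show ?thesis
      using I subspace_0 unfolding two_sided_ideal_of_def by blast
  next
    case False
    have sub: "subspace I" and IC: "I \<subseteq> unit_span T E"
      and ideal: "\<And>c x. c \<in> unit_span T E \<Longrightarrow> x \<in> I \<Longrightarrow> c * x \<in> I \<and> x * c \<in> I"
      using I unfolding two_sided_ideal_of_def by blast+
    obtain x where x: "x \<in> I" "x \<noteq> 0" using False by blast
    obtain c where c: "x = (\<Sum>s\<in>T. \<Sum>t\<in>T. c s t *s E s t)"
      using unit_spanE x(1) IC by blast
    obtain s t where st: "s \<in> T" "t \<in> T" "c s t \<noteq> 0"
    proof (rule ccontr)
      assume "\<not> thesis"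
      then have "c s t = 0" if "s \<in> T" "t \<in> T" for s t
        using that \<open>\<And>s t. s \<in> T \<Longrightarrow> t \<in> T \<Longrightarrow> c s t \<noteq> 0 \<Longrightarrow> thesis\<close> by blast
      then have "x = 0"
        unfolding c by (intro sum.neutral ballI) simp
      then show False using x(2) by simp
    qed
    have units: "E p q \<in> I" if pq: "p \<in> T" "q \<in> T" for p q
    proof -
      have "E p s * x * E t q \<in> I"
        using ideal x(1) unit_in_span pq st by blast
      then have "inverse (c s t) *s (c s t *s E p q) \<in> I"
        unfolding c coefficient_extraction[OF pq st(1,2)] using subspace_scale[OF sub] by blast
      then show ?thesis using st(3) by simp
    qed
    have "unit_span T E \<subseteq> I"
      unfolding unit_span_def using sub units by (intro span_minimal) auto
    then show ?thesis using IC by blast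
  qed
qed

end

end

section \<open>A primitive idempotent and the simple subalgebra\<close>

lemma corner_unit_not_nilpotent:
  fixes a :: "'a::ring_1"
  assumes ab: "a * b = f" and af: "a * f = a" and nil: "a ^ n = 0"
  shows "f = 0"
proof -
  have "a ^ Suc k * b ^ Suc k = f" for k
  proof (induction k)
    case 0
    show ?case using ab by simp
  next
    case (Suc k)
    have "a ^ Suc (Suc k) * b ^ Suc (Suc k) = a ^ k * (a * (a * b)) * b ^ Suc k"
      by (simp only: power_Suc2[of a] power_Suc[of b] mult.assoc)
    also have "\<dots> = a ^ Suc k * b ^ Suc k"
      by (simp only: ab af power_Suc2[of a])
    finally show ?case using Suc by simp
  qed
  from this[of n] show ?thesis
    using nil by simp
qed

lemma one_minus_nilpotent_right_inverse:
  fixes a :: "'a::ring_1"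
  assumes "a ^ n = 0"
  shows "\<exists>b. (1 - a) * b = 1"
proof -
  have "(1 - a) * (\<Sum>i<k. a ^ i) = 1 - a ^ k" for k
    by (induction k) (simp_all add: distrib_left left_diff_distrib)
  from this[of n] show ?thesis
    using assms by auto
qed

lemma power_mult_commuting:
  fixes a b :: "'a::monoid_mult"
  assumes "a * b = b * a"
  shows "(a * b) ^ n = a ^ n * b ^ n"
proof (induction n)
  case (Suc n)
  have "(a * b) ^ Suc n = a * (b * a ^ n) * b ^ n"
    by (simp add: Suc mult.assoc)
  also have "b * a ^ n = a ^ n * b"
    using power_commuting_commutes[OF assms] by simp
  finally show ?case by (simp add: mult.assoc)
qed simp

lemma (in unital_algebra) power_scale: "(c *s x) ^ n = c ^ n *s x ^ n"
  by (induction n) (simp_all add: scale_mult_left scale_mult_right mult.commute)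

locale regular_qc_units_closed = regular_qc_units scale Basis m R \<theta> e u v
  for scale :: "'k::alg_closed_field \<Rightarrow> 'a::ring_1 \<Rightarrow> 'a" (infixr \<open>*s\<close> 75)
    and Basis m R \<theta> e u v +
  fixes H T
  assumes H: "lagrangian H" and T: "coset_representatives H T"
begin

lemmas H_subset = lagrangian_subset[OF H T]
lemmas T_subset = representatives_subset[OF H T]

text \<open>
  Membership in the centralizer of the units \<open>u h\<close>, \<open>h \<in> H\<close>, within \<open>e R\<close>.
\<close>
definition centralizing :: "'a \<Rightarrow> bool" where
  "centralizing x \<longleftrightarrow> e * x = x \<and> (\<forall>h\<in>H. u h * x = x * u h)"

lemma centralizing_e: "centralizing x \<Longrightarrow> e * x = x" "centralizing x \<Longrightarrow> x * e = x"
  using e_central unfolding centralizing_def by metis+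

lemma centralizingD: "centralizing x \<Longrightarrow> h \<in> H \<Longrightarrow> u h * x = x * u h"
  by (simp add: centralizing_def)

lemma centralizing_identity: "centralizing e"
  unfolding centralizing_def using e_idem e_central by metis

lemma centralizing_unit: "h \<in> H \<Longrightarrow> centralizing (u h)"
proof -
  assume h: "h \<in> H"
  then have hm: "h \<in> {1..m}" using H_subset by blast
  have "u k * u h = u h * u k" if "k \<in> H" for k
  proof -
    have "k \<in> {1..m}" using that H_subset by blast
    then show ?thesis
      using weightD[OF weight_u[OF hm], of k] lagrangian_isotropic[OF H T that h] by simp
  qed
  then show ?thesis
    unfolding centralizing_def using e_u[OF hm] by blast
qed

lemma centralizing_mult: "centralizing x \<Longrightarrow> centralizing y \<Longrightarrow> centralizing (x * y)"
  unfolding centralizing_def by (metis mult.assoc)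

lemma centralizing_diff: "centralizing x \<Longrightarrow> centralizing y \<Longrightarrow> centralizing (x - y)"
  unfolding centralizing_def by (simp add: left_diff_distrib right_diff_distrib)

lemma centralizing_scale: "centralizing x \<Longrightarrow> centralizing (c *s x)"
  unfolding centralizing_def by (simp add: scale_mult_left scale_mult_right)

lemma centralizing_components:
  assumes x: "centralizing x"
  obtains a where "\<And>i. i \<in> {1..m} \<Longrightarrow> \<exists>r\<in>R i. a i = e * r" "x = (\<Sum>i\<in>{1..m}. a i)"
    "\<And>i. i \<in> {1..m} \<Longrightarrow> i \<notin> H \<Longrightarrow> a i = 0"
proof -
  obtain a where a: "\<And>i. i \<in> {1..m} \<Longrightarrow> \<exists>r\<in>R i. a i = e * r" "e * x = (\<Sum>i\<in>{1..m}. a i)"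
    using corner_components[of x] by blast
  have x_sum: "x = (\<Sum>i\<in>{1..m}. a i)"
    using a(2) centralizing_e[OF x] by simp
  have "a i = 0" if i: "i \<in> {1..m}" "i \<notin> H" for i
  proof -
    obtain h where h: "h \<in> H" "\<theta> h i \<noteq> 1"
      using lagrangianI[OF H T i(1)] i(2) by blast
    have "h \<in> {1..m}" using h(1) H_subset by blast
    moreover have "u h * (\<Sum>i\<in>{1..m}. a i) = (\<Sum>i\<in>{1..m}. a i) * u h"
      using centralizingD[OF x h(1)] x_sum by simp
    ultimately show ?thesis
      using component_zero_if_commutes[OF a(1) _ _ i(1) h(2)] by blast
  qed
  then show ?thesis
    using that a(1) x_sum by blast
qed

text \<open>
  An element of the centralizer has nonzero components only at indices orthogonal to \<open>H\<close>, that is,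
  in \<open>H\<close> itself; and components with index in \<open>H\<close> commute with each other, since \<open>H\<close> is isotropic.
\<close>
lemma centralizing_commute:
  assumes x: "centralizing x" and y: "centralizing y"
  shows "x * y = y * x"
proof -
  obtain a where a: "\<And>i. i \<in> {1..m} \<Longrightarrow> \<exists>r\<in>R i. a i = e * r" "x = (\<Sum>i\<in>{1..m}. a i)"
    "\<And>i. i \<in> {1..m} \<Longrightarrow> i \<notin> H \<Longrightarrow> a i = 0"
    using centralizing_components[OF x] by blast
  obtain b where b: "\<And>i. i \<in> {1..m} \<Longrightarrow> \<exists>r\<in>R i. b i = e * r" "y = (\<Sum>i\<in>{1..m}. b i)"
    "\<And>i. i \<in> {1..m} \<Longrightarrow> i \<notin> H \<Longrightarrow> b i = 0"
    using centralizing_components[OF y] by blast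
  have comm: "a i * b j = b j * a i" if ij: "i \<in> {1..m}" "j \<in> {1..m}" for i j
  proof (cases "i \<in> H \<and> j \<in> H")
    case True
    obtain r where r: "r \<in> R i" "a i = e * r" using a(1) ij by blast
    obtain s where s: "s \<in> R j" "b j = e * s" using b(1) ij by blast
    have rs: "r * s = s * r"
      using component_commute[OF ij r(1) s(1)] lagrangian_isotropic[OF H T] True by simp
    have "a i * b j = e * e * (r * s)"
      unfolding r(2) s(2) using e_central[of r] by (metis mult.assoc)
    also have "\<dots> = b j * a i"
      unfolding rs r(2) s(2) using e_central[of s] by (metis mult.assoc)
    finally show ?thesis .
  next
    case False
    then show ?thesis using a(3) b(3) ij by auto
  qed
  have "x * y = (\<Sum>i\<in>{1..m}. \<Sum>j\<in>{1..m}. a i * b j)"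
    by (simp add: a(2) b(2) sum_product)
  also have "\<dots> = (\<Sum>i\<in>{1..m}. \<Sum>j\<in>{1..m}. b j * a i)"
    using comm by (intro sum.cong) auto
  also have "\<dots> = (\<Sum>j\<in>{1..m}. \<Sum>i\<in>{1..m}. b j * a i)"
    by (rule sum.swap)
  also have "\<dots> = y * x"
    by (simp add: a(2) b(2) sum_product)
  finally show ?thesis .
qed

definition primitive :: "'a \<Rightarrow> bool" where
  "primitive f \<longleftrightarrow> f \<noteq> 0 \<and> f * f = f \<and> centralizing f \<and>
     (\<forall>g. g * g = g \<longrightarrow> centralizing g \<longrightarrow> g * f = g \<longrightarrow> g = 0 \<or> g = f)"

lemma exists_primitive: "\<exists>f. primitive f"
proof -
  define P where "P f \<longleftrightarrow> f \<noteq> 0 \<and> f * f = f \<and> centralizing f" for f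
  have "P e"
    using e_nonzero e_idem centralizing_identity by (simp add: P_def)
  then obtain f where f: "P f" and least: "\<And>g. P g \<Longrightarrow> dim (range ((*) f)) \<le> dim (range ((*) g))"
    using ex_has_least_nat[of P e "\<lambda>f. dim (range ((*) f))"] by blast
  have "g = 0 \<or> g = f" if g: "g * g = g" "centralizing g" "g * f = g" for g
  proof (rule ccontr)
    assume "\<not> (g = 0 \<or> g = f)"
    moreover have "f * g = g"
      using centralizing_commute[of f g] f g by (simp add: P_def)
    ultimately have "dim (range ((*) g)) < dim (range ((*) f))" "P g"
      using dim_corner_less[of f g] g by (auto simp: P_def)
    then show False
      using least[of g] by simp
  qed
  then show ?thesis
    using f unfolding primitive_def P_def by blast
qed

context
  fixes f
  assumes f: "primitive f"
begin

lemma primitive_nonzero: "f \<noteq> 0"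
  and primitive_idem: "f * f = f"
  and primitive_centralizing: "centralizing f"
  and primitive_minimal: "g * g = g \<Longrightarrow> centralizing g \<Longrightarrow> g * f = g \<Longrightarrow> g = 0 \<or> g = f"
  using f unfolding primitive_def by blast+

text \<open>
  The Fitting idempotent of \<open>z\<close> lies in the centralizer below \<open>f\<close>, hence is \<open>0\<close> or \<open>f\<close>.
\<close>
lemma primitive_nilpotent_or_unit:
  assumes z: "centralizing z" "f * z = z"
  shows "(\<exists>n. z ^ n = 0) \<or> (\<exists>y. y * z = f)"
proof -
  obtain g k y n where g: "g * g = g" "g = z ^ n * k" "g = k * z ^ n" "z ^ n * g = z ^ n"
      "g * z ^ n = z ^ n" "g = z * y" "\<And>x. z * x = x * z \<Longrightarrow> g * x = x * g \<and> y * x = x * y"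
    using fitting_idempotent[of z] by metis
  have "e * g = g"
    using centralizing_e[OF z(1)] by (simp add: g(6) mult.assoc[symmetric])
  moreover have "u h * g = g * u h" if "h \<in> H" for h
    using g(7)[of "u h"] centralizingD[OF z(1) that] by simp
  ultimately have "centralizing g"
    by (simp add: centralizing_def)
  moreover have "g * f = g"
  proof -
    have "g * f = f * g"
      using centralizing_commute \<open>centralizing g\<close> primitive_centralizing by blast
    also have "\<dots> = g"
      using z(2) by (simp add: g(6) mult.assoc[symmetric])
    finally show ?thesis .
  qed
  ultimately have "g = 0 \<or> g = f"
    using primitive_minimal g(1) by blast
  then show ?thesis
  proof
    assume "g = 0"
    then have "z ^ n = 0" using g(4) by simp
    then show ?thesis by blast
  next
    assume "g = f"
    then have "y * z = f" using g(6) g(7)[of z] by simp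
    then show ?thesis by blast
  qed
qed

text \<open>
  Let \<open>p\<close> be a polynomial of least degree that annihilates \<open>x\<close> on \<open>f\<close> and split off a root \<open>l\<close>, which
  exists as \<open>K\<close> is algebraically closed. By the choice of \<open>p\<close> the remaining factor does not vanish
  at \<open>x\<close> on \<open>f\<close>, so \<open>x - l\<close> is not invertible on \<open>f\<close>; therefore it is nilpotent there.
\<close>
lemma primitive_eigenvalue:
  assumes x: "centralizing x"
  shows "\<exists>l n. (f * x - l *s f) ^ n = 0"
proof -
  define P where "P p \<longleftrightarrow> p \<noteq> 0 \<and> f * peval x p = 0" for p
  obtain p0 where "P p0"
    using annihilating_poly[of x] unfolding P_def by (metis mult_zero_right)
  then obtain p where p: "P p" and least: "\<And>q. P q \<Longrightarrow> degree p \<le> degree q"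
    using ex_has_least_nat[of P p0 degree] by blast
  have "degree p \<noteq> 0"
  proof
    assume "degree p = 0"
    then obtain c where "p = [:c:]" using degree_eq_zeroE by blast
    then show False
      using p primitive_nonzero unfolding P_def by (simp add: scale_mult_right)
  qed
  then obtain l where "poly p l = 0"
    using alg_closed_imp_poly_has_root[of p] by auto
  then obtain q where pq: "p = [:- l, 1:] * q"
    by (auto simp: poly_eq_0_iff_dvd elim: dvdE)
  have q0: "q \<noteq> 0"
    using p pq unfolding P_def by auto
  then have "degree p = Suc (degree q)"
    unfolding pq by (subst degree_mult_eq) auto
  then have "\<not> P q"
    using least[of q] by auto
  then have fq: "f * peval x q \<noteq> 0"
    using q0 by (simp add: P_def)
  have "peval x p = x * peval x q - l *s peval x q"
    by (simp add: pq mult_pCons_left peval_diff peval_smult)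
  then have "(f * x - l *s f) * peval x q = f * peval x p"
    by (simp add: left_diff_distrib right_diff_distrib scale_mult_left scale_mult_right mult.assoc)
  then have zq: "(f * x - l *s f) * peval x q = 0"
    using p by (simp add: P_def)
  have "centralizing (f * x - l *s f)"
    using x primitive_centralizing
    by (intro centralizing_diff centralizing_mult centralizing_scale)
  moreover have "f * (f * x - l *s f) = f * x - l *s f"
    by (simp add: right_diff_distrib scale_mult_right primitive_idem mult.assoc[symmetric])
  ultimately consider n where "(f * x - l *s f) ^ n = 0" | y where "y * (f * x - l *s f) = f"
    using primitive_nilpotent_or_unit by blast
  then show ?thesis
  proof cases
    case 1
    then show ?thesis by blast
  next
    case 2
    have "f * peval x q = y * ((f * x - l *s f) * peval x q)"
      using 2 by (simp add: mult.assoc[symmetric])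
    then show ?thesis using zq fq by simp
  qed
qed

text \<open>
  The conjugate \<open>p = w * f * w'\<close> is again an idempotent of the centralizer, so \<open>f * p\<close> is \<open>0\<close> or \<open>f\<close>
  by primitivity. In the first case the claim follows. The second case is impossible: \<open>u h\<close> has on
  \<open>f\<close> a single eigenvalue \<open>l \<noteq> 0\<close>; conjugating by \<open>w\<close> shows that its eigenvalue on \<open>p\<close>, hence on
  \<open>f = f * p\<close>, is \<open>\<chi> h * l\<close>, which differs from \<open>l\<close>.
\<close>
lemma primitive_annihilates:
  assumes w: "weight \<chi> w" "weight (\<lambda>k. inverse (\<chi> k)) w'" "w * w' = e" "w' * w = e"
    and \<chi>: "\<And>k. k \<in> {1..m} \<Longrightarrow> \<chi> k \<noteq> 0" and h: "h \<in> H" "\<chi> h \<noteq> 1"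
  shows "f * w * f = 0"
proof -
  note cf = primitive_centralizing
  have hm: "h \<in> {1..m}" using h(1) H_subset by blast
  define p where "p = w * f * w'"
  have fe: "f * e = f" "e * f = f"
    using centralizing_e[OF cf] by auto
  have cp: "centralizing p"
    unfolding centralizing_def
  proof (intro conjI ballI)
    show "e * p = p"
      using weight_e_mult[OF w(1)] by (simp add: p_def mult.assoc[symmetric])
    fix k assume k: "k \<in> H"
    then have km: "k \<in> {1..m}" using H_subset by blast
    have "u k * p = \<chi> k *s (w * (u k * f) * w')"
      by (simp add: p_def weightD[OF w(1) km] scale_mult_left mult.assoc[symmetric])
    also have "\<dots> = \<chi> k *s (w * f * (u k * w'))"
      by (simp add: centralizingD[OF cf k] mult.assoc)
    also have "\<dots> = p * u k"
      by (simp add: p_def weightD[OF w(2) km] scale_mult_right \<chi>[OF km] mult.assoc)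
    finally show "u k * p = p * u k" .
  qed
  have pp: "p * p = p"
  proof -
    have "p * p = w * (f * (w' * w) * f) * w'"
      by (simp add: p_def mult.assoc)
    then show ?thesis
      by (simp add: w(4) fe primitive_idem p_def)
  qed
  have fp: "f * p = p * f"
    using centralizing_commute cf cp by blast
  have "f * p * (f * p) = f * (p * f) * p"
    by (simp add: mult.assoc)
  also have "\<dots> = f * f * (p * p)"
    unfolding fp[symmetric] by (simp add: mult.assoc)
  finally have "f * p * (f * p) = f * p"
    by (simp add: primitive_idem pp)
  moreover have "f * p * f = f * p"
  proof -
    have "f * p * f = f * (f * p)" by (simp only: fp[symmetric] mult.assoc)
    then show ?thesis by (simp add: primitive_idem mult.assoc[symmetric])
  qed
  ultimately consider "f * p = 0" | "f * p = f"
    using primitive_minimal centralizing_mult[OF cf cp] by blast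
  then show ?thesis
  proof cases
    case 1
    have "f * w * f = f * w * (f * e)"
      by (simp add: fe)
    also have "\<dots> = f * p * w"
      by (simp add: p_def w(4)[symmetric] mult.assoc)
    finally show ?thesis using 1 by simp
  next
    case 2
    define U where "U = f * u h"
    have uf: "u h * f = U"
      using centralizingD[OF cf h(1)] by (simp add: U_def)
    have fU: "f * U = U" and Uf: "U * f = U"
      by (simp_all add: U_def primitive_idem mult.assoc[symmetric])
        (simp add: mult.assoc uf, simp add: U_def primitive_idem mult.assoc[symmetric])
    obtain l n where nil: "(U - l *s f) ^ n = 0"
      using primitive_eigenvalue[OF centralizing_unit[OF h(1)]] unfolding U_def by blast
    define N where "N = U - l *s f"
    have fN: "f * N = N" and Nf: "N * f = N"
      by (simp_all add: N_def right_diff_distrib left_diff_distrib fU Uf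
          scale_mult_left scale_mult_right primitive_idem)
    have l0: "l \<noteq> 0"
    proof
      assume "l = 0"
      then have "U ^ n = 0" using nil by simp
      moreover have "U * v h = f"
        by (simp add: U_def mult.assoc u_v[OF hm] fe)
      ultimately have "f = 0"
        using corner_unit_not_nilpotent[OF _ Uf] by blast
      then show False using primitive_nonzero by simp
    qed
    \<comment> \<open>The nilpotent element \<open>N\<close> transported to \<open>p\<close>, where \<open>u h\<close> is scaled by \<open>inverse (\<chi> h)\<close>.\<close>
    define q where "q = w * N * w'"
    have "q ^ Suc k = w * N ^ Suc k * w'" for k
    proof (induction k)
      case (Suc k)
      have "q ^ Suc (Suc k) = w * N * (w' * w) * N ^ Suc k * w'"
        by (subst power_Suc) (simp only: Suc, simp only: q_def mult.assoc)
      also have "\<dots> = w * (N * (w' * w)) * N ^ Suc k * w'"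
        by (simp only: mult.assoc)
      also have "N * (w' * w) = N"
        by (metis w(4) Nf fe(1) mult.assoc)
      finally show ?case
        by (simp add: mult.assoc)
    qed (simp add: q_def)
    from this[of n] have q_nil: "q ^ Suc n = 0"
      using nil by (simp add: N_def)
    have wuh: "w * u h = inverse (\<chi> h) *s (u h * w)"
      using weightD[OF w(1) hm] \<chi>[OF hm] by simp
    have "w * U * w' = w * u h * f * w'"
      by (simp add: uf[symmetric] mult.assoc)
    also have "\<dots> = inverse (\<chi> h) *s (u h * p)"
      by (simp add: wuh p_def scale_mult_left mult.assoc)
    finally have q_eq: "q = inverse (\<chi> h) *s (u h * p) - l *s p"
      by (simp add: q_def N_def p_def left_diff_distrib right_diff_distrib
          scale_mult_left scale_mult_right)
    have "centralizing q"
      unfolding q_eq using cp centralizing_unit[OF h(1)]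
      by (intro centralizing_diff centralizing_mult centralizing_scale)
    then have "(f * q) ^ Suc n = f ^ Suc n * q ^ Suc n"
      using centralizing_commute[OF cf] by (intro power_mult_commuting) blast
    then have fq_nil: "(f * q) ^ Suc n = 0"
      using q_nil by simp
    have "f * (u h * p) = u h * (f * p)"
      using centralizingD[OF cf h(1)] by (simp add: mult.assoc[symmetric])
    then have fq: "f * q = inverse (\<chi> h) *s U - l *s f"
      by (simp add: q_eq right_diff_distrib scale_mult_right 2 uf)
    \<comment> \<open>Since \<open>U\<close> is \<open>l *s f\<close> plus a nilpotent element, the nilpotent element \<open>f * q\<close> is \<open>c *s f\<close> plus a
       nilpotent element, hence also a unit on \<open>f\<close>.\<close>
    define c where "c = (inverse (\<chi> h) - 1) * l"
    have c0: "c \<noteq> 0"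
      using l0 h(2) by (simp add: c_def)
    define a where "a = (- inverse (\<chi> h) / c) *s N"
    have "a ^ n = 0"
      unfolding a_def power_scale using nil by (simp add: N_def)
    then obtain b where b: "(1 - a) * b = 1"
      using one_minus_nilpotent_right_inverse by blast
    have "f * q = inverse (\<chi> h) *s N + c *s f"
      unfolding fq N_def c_def
      by (simp add: scale_right_diff_distrib scale_left_diff_distrib left_diff_distrib)
    also have "\<dots> = c *s (f * (1 - a))"
      using c0 by (simp add: a_def distrib_left scale_mult_right fN
          scale_right_distrib)
    finally have "f * q * (inverse c *s b) = f * ((1 - a) * b)"
      using c0 by (simp add: scale_mult_left scale_mult_right mult.assoc)
    then have "f * q * (inverse c *s b) = f"
      by (simp add: b)
    moreover have "f * q * f = f * q"
      unfolding fq by (simp add: left_diff_distrib scale_mult_left Uf primitive_idem)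
    ultimately have "f = 0"
      using corner_unit_not_nilpotent[OF _ _ fq_nil] by blast
    then show ?thesis by simp
  qed
qed

lemma primitive_matrix_units:
  assumes st: "s \<in> T" "t \<in> T" "s' \<in> T" "t' \<in> T"
  shows "u s * f * v t * (u s' * f * v t') = (if t = s' then u s * f * v t' else 0)"
proof -
  have m: "s \<in> {1..m}" "t \<in> {1..m}" "s' \<in> {1..m}" "t' \<in> {1..m}"
    using st T_subset by blast+
  have eq: "u s * f * v t * (u s' * f * v t') = u s * (f * (v t * u s') * f) * v t'"
    by (simp add: mult.assoc)
  show ?thesis
  proof (cases "t = s'")
    case True
    then have "f * (v t * u s') * f = f"
      using v_u[OF m(2)] centralizing_e[OF primitive_centralizing] primitive_idem by simp
    then show ?thesis using eq True by simp
  next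
    case False
    obtain h where h: "h \<in> H" "\<theta> h t \<noteq> \<theta> h s'"
      using representatives_separated[OF H T st(2,3) False] by blast
    have hm: "h \<in> {1..m}" using h(1) H_subset by blast
    have "f * (v t * u s') * f = 0"
    proof (rule primitive_annihilates[OF weight_mult[OF weight_v[OF m(2)] weight_u[OF m(3)]]])
      show "weight (\<lambda>k. inverse (inverse (\<theta> k t) * \<theta> k s')) (v s' * u t)"
        using weight_mult[OF weight_v[OF m(3)] weight_u[OF m(2)]] by (simp add: mult.commute)
      have "v t * u s' * (v s' * u t) = v t * (u s' * v s') * u t"
        "v s' * u t * (v t * u s') = v s' * (u t * v t) * u s'"
        by (simp_all add: mult.assoc)
      then show "v t * u s' * (v s' * u t) = e" "v s' * u t * (v t * u s') = e"
        using m by (simp_all add: u_v v_u v_e)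
      show "inverse (\<theta> k t) * \<theta> k s' \<noteq> 0" if "k \<in> {1..m}" for k
        using theta_nonzero that m by simp
      show "inverse (\<theta> h t) * \<theta> h s' \<noteq> 1"
        using h(2) theta_nonzero[OF hm m(2)] by (simp add: field_simps)
    qed (fact h(1))
    then show ?thesis using eq False by simp
  qed
qed

lemma primitive_matrix_units_nonzero:
  assumes st: "s \<in> T" "t \<in> T"
  shows "u s * f * v t \<noteq> 0"
proof
  assume zero: "u s * f * v t = 0"
  have m: "s \<in> {1..m}" "t \<in> {1..m}"
    using st T_subset by blast+
  have "f = e * f * e"
    using centralizing_e[OF primitive_centralizing] by simp
  also have "\<dots> = v s * (u s * f * v t) * u t"
    using v_u[OF m(1)] v_u[OF m(2)] by (simp add: mult.assoc[symmetric]) (simp add: mult.assoc)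
  finally show False
    using zero primitive_nonzero by simp
qed

end

lemma exists_simple_subalgebra:
  assumes m: "of_nat m \<noteq> (0 :: 'k)"
  shows "\<exists>C. simple_subalgebra C \<and> dim C = m"
proof -
  obtain f where f: "primitive f"
    using exists_primitive by blast
  have card: "card T = card H" "m = card T * card H"
    using card_representatives[OF H T m] card_product[OF H T] by auto
  have "finite T" "T \<noteq> {}"
    using finite_H_T[OF H T] card m by auto
  note units = this primitive_matrix_units[OF f] primitive_matrix_units_nonzero[OF f]
  let ?C = "unit_span T (\<lambda>s t. u s * f * v t)"
  have "simple_subalgebra ?C"
    by (rule simple_subalgebra_unit_span) (fact units)+
  moreover have "dim ?C = card T * card T"
    by (rule dim_unit_span) (fact units)+
  ultimately show ?thesis
    using card by auto
qed

end

section \<open>The determinant\<close>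

context regular_qc_units
begin

text \<open>
  Orthogonality of characters reads \<open>M * M = m \<cdot> 1\<close> without a transpose or an inverse, because
  \<open>\<theta> j i\<close> is already the inverse of \<open>\<theta> i j\<close>.
\<close>
lemma decomposition_matrix_square:
  "decomposition_matrix m \<theta> * decomposition_matrix m \<theta> = of_nat m \<cdot>\<^sub>m 1\<^sub>m m"
proof (rule eq_matI)
  fix i j assume "i < dim_row (of_nat m \<cdot>\<^sub>m (1\<^sub>m m :: 'k mat))"
    "j < dim_col (of_nat m \<cdot>\<^sub>m (1\<^sub>m m :: 'k mat))"
  then have ij: "i < m" "j < m" by simp_all
  have "(decomposition_matrix m \<theta> * decomposition_matrix m \<theta>) $$ (i, j) =
      (\<Sum>k\<in>{0..<m}. \<theta> (Suc i) (Suc k) * \<theta> (Suc k) (Suc j))"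
    using ij by (simp add: decomposition_matrix_def scalar_prod_def)
  also have "\<dots> = (\<Sum>k\<in>{1..m}. \<theta> (Suc i) k * \<theta> k (Suc j))"
    by (rule sum.reindex_bij_witness[of _ "\<lambda>k. k - 1" Suc]) auto
  also have "\<dots> = (if i = j then of_nat m else 0)"
    using orthogonality[of "Suc i" "Suc j"] ij by simp
  finally show "(decomposition_matrix m \<theta> * decomposition_matrix m \<theta>) $$ (i, j) =
      (of_nat m \<cdot>\<^sub>m 1\<^sub>m m) $$ (i, j)"
    using ij by simp
qed (simp_all add: decomposition_matrix_def)

lemma det_decomposition_matrix_square:
  "det (decomposition_matrix m \<theta>) * det (decomposition_matrix m \<theta>) = of_nat m ^ m"
proof -
  have "decomposition_matrix m \<theta> \<in> carrier_mat m m"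
    by (simp add: decomposition_matrix_def)
  then have "det (decomposition_matrix m \<theta>) * det (decomposition_matrix m \<theta>) =
      det (of_nat m \<cdot>\<^sub>m 1\<^sub>m m)"
    by (simp add: det_mult[symmetric] decomposition_matrix_square)
  then show ?thesis by simp
qed

end

lemma minimal_decomposition_if_det_nonzero:
  fixes \<theta> :: "nat \<Rightarrow> nat \<Rightarrow> 'k::field"
  assumes "det (decomposition_matrix m \<theta>) \<noteq> 0"
  shows "minimal_decomposition m \<theta>"
  unfolding minimal_decomposition_def
proof (intro allI impI)
  fix i j assume ij: "i < m" "j < m" "i \<noteq> j"
  have "decomposition_matrix m \<theta> \<in> carrier_mat m m"
    by (simp add: decomposition_matrix_def)
  then show "col (decomposition_matrix m \<theta>) i \<noteq> col (decomposition_matrix m \<theta>) j"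
    using det_identical_columns ij assms by metis
qed

lemma minimal_decomposition_columns:
  assumes "minimal_decomposition m \<theta>" "i \<in> {1..m}" "j \<in> {1..m}"
    and "\<And>k. k \<in> {1..m} \<Longrightarrow> \<theta> k i = \<theta> k j"
  shows "i = j"
proof (rule ccontr)
  assume "i \<noteq> j"
  then have "i - 1 \<noteq> j - 1" "i - 1 < m" "j - 1 < m"
    using assms(2,3) by auto
  then have "col (decomposition_matrix m \<theta>) (i - 1) \<noteq> col (decomposition_matrix m \<theta>) (j - 1)"
    using assms(1) unfolding minimal_decomposition_def by blast
  moreover have "col (decomposition_matrix m \<theta>) (i - 1) = col (decomposition_matrix m \<theta>) (j - 1)"
    using assms(2-4) by (intro eq_vecI) (auto simp: decomposition_matrix_def)
  ultimately show False by contradiction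
qed

lemma (in unital_algebra) exists_finite_basis:
  assumes finite_dimensional
  obtains B where "finite_dimensional_vector_space scale B"
proof -
  obtain G where G: "finite G" "span G = UNIV"
    using assms unfolding finite_dimensional_def by blast
  obtain B where B: "B \<subseteq> G" "independent B" "G \<subseteq> span B"
    using maximal_independent_subset[of G] by blast
  have "span B = UNIV"
    using G(2) span_minimal[OF B(3) subspace_span] by blast
  then have "finite_dimensional_vector_space scale B"
    using B finite_subset[OF B(1) G(1)] by unfold_locales auto
  then show ?thesis by (rule that)
qed

theorem theorem48:
  fixes scale :: "'k::alg_closed_field \<Rightarrow> 'a::ring_1 \<Rightarrow> 'a"
    and m :: nat
    and R :: "nat \<Rightarrow> 'a set"
    and \<theta> :: "nat \<Rightarrow> nat \<Rightarrow> 'k"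
  assumes "unital_algebra scale"
    and "unital_algebra.finite_dimensional scale"
    and "CHAR('k) \<noteq> 2"
    and "unital_algebra.regular_qc_decomposition scale m R \<theta>"
    and "\<not> CHAR('k) dvd m"
  shows "(minimal_decomposition m \<theta> \<longleftrightarrow> det (decomposition_matrix m \<theta>) \<noteq> 0) \<and>
    (minimal_decomposition m \<theta> \<longrightarrow>
       (\<exists>C. unital_algebra.simple_subalgebra scale C \<and> m = vector_space.dim scale C) \<and>
       (\<exists>k::nat. real k = real m powr (real m / 2) \<and>
          (det (decomposition_matrix m \<theta>) = of_nat k \<or>
           det (decomposition_matrix m \<theta>) = - of_nat k)))"
proof -
  interpret unital_algebra scale by fact
  obtain B where B: "finite_dimensional_vector_space scale B"
    using exists_finite_basis assms(2) by blast
  interpret finite_dimensional_vector_space scale B by fact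
  interpret regular_qc_algebra scale B m R \<theta>
    by unfold_locales fact
  have m: "of_nat m \<noteq> (0 :: 'k)"
    using assms(5) by (simp add: of_nat_eq_0_iff_char_dvd)
  let ?d = "det (decomposition_matrix m \<theta>)"
  have main: "?d \<noteq> 0 \<and> (\<exists>C. simple_subalgebra C \<and> m = dim C) \<and>
      (\<exists>k::nat. real k = real m powr (real m / 2) \<and> (?d = of_nat k \<or> ?d = - of_nat k))"
    if minimal: "minimal_decomposition m \<theta>"
  proof -
    obtain e u v where euv: "e * e = e" "e \<noteq> 0" "\<And>r. e * r = r * e"
      "\<And>i. i \<in> {1..m} \<Longrightarrow> \<exists>x\<in>R i. u i = e * x"
      "\<And>i. i \<in> {1..m} \<Longrightarrow> u i * v i = e"
      "\<And>i. i \<in> {1..m} \<Longrightarrow> v i * u i = e"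
      "\<And>i. i \<in> {1..m} \<Longrightarrow> e * v i = v i"
      using exists_homogeneous_units by metis
    interpret regular_qc_units scale B m R \<theta> e u v
      by unfold_locales (fact euv minimal_decomposition_columns[OF minimal])+
    obtain H where H: "lagrangian H"
      using exists_lagrangian by blast
    obtain T where T: "coset_representatives H T"
      using exists_coset_representatives by blast
    interpret regular_qc_units_closed scale B m R \<theta> e u v H T
      by unfold_locales (fact H T)+
    have "?d * ?d \<noteq> 0"
      using det_decomposition_matrix_square m by simp
    then have "?d \<noteq> 0" by auto
    moreover have "\<exists>C. simple_subalgebra C \<and> m = dim C"
      using exists_simple_subalgebra[OF m] by blast
    moreover have "\<exists>k::nat. real k = real m powr (real m / 2) \<and> (?d = of_nat k \<or> ?d = - of_nat k)"
    proof -
      define n where "n = card H"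
      have mn: "m = n * n"
        using card_product[OF H T] card_representatives[OF H T m] by (simp add: n_def)
      have n: "n > 0"
        using m mn by (cases n) auto
      have "real m = real n powr 2"
        using n by (simp add: mn power2_eq_square)
      then have "real m powr (real m / 2) = (real n powr 2) powr (real m / 2)"
        by (simp only:)
      also have "\<dots> = real n powr real m"
        by (simp only: powr_powr) simp
      also have "\<dots> = real (n ^ m)"
        using n by (simp add: powr_realpow)
      finally have "real (n ^ m) = real m powr (real m / 2)" ..
      moreover have "?d = of_nat (n ^ m) \<or> ?d = - of_nat (n ^ m)"
      proof -
        have "of_nat m = (of_nat n * of_nat n :: 'k)"
          by (subst mn) simp
        then have "?d * ?d = of_nat (n ^ m) * of_nat (n ^ m)"
          using det_decomposition_matrix_square by (simp add: power_mult_distrib)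
        then show ?thesis
          by (simp only: square_eq_iff)
      qed
      ultimately show ?thesis by blast
    qed
    ultimately show ?thesis by blast
  qed
  then show ?thesis
    using minimal_decomposition_if_det_nonzero by blast
qed

end
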